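(* Let $J\in L^2(\Omega)^3$, let $\alpha\in\mathbb{R}$ with $\alpha\neq0$, and let $\omega\in\mathbb{R}$ be such that $\omega^2$ is not an eigenvalue of the conforming discrete operator $\widetilde{\operatorname{curl}}^c_h\operatorname{curl}^c_h:V^{1,c}_h\to V^{1,c}_h$. Then the equation: find $u_h\in V^1_h$ such that $$\big(-\omega^2(P^1_h)^*P^1_h+\widetilde{\operatorname{curl}}_h\operatorname{curl}_h+\alpha S^1_h\big)u_h=\tilde\Pi^1_hJ$$ admits a unique solution $u_h$. This solution belongs to the conforming space $V^{1,c}_h=V^1_h\cap H_0(\operatorname{curl};\Omega)$ and solves the conforming FEEC Maxwell problem $$-\omega^2\langle v^c,u_h\rangle+\langle\operatorname{curl}v^c,\operatorname{curl}u_h\rangle=\langle v^c,J\rangle\qquad\forall\,v^c\in V^{1,c}_h.$$ In particular, $u_h$ is independent of both $\alpha$ and the specific projection $P^1_h$.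
   Context: $\langle\cdot,\cdot\rangle$ is the $L^2(\Omega)$ scalar product and $A^*$ denotes the $L^2$-adjoint of a linear operator $A$ between the finite-dimensional spaces below. Let $\Omega\subset\mathbb{R}^3$ be a domain decomposed in a partition of open subdomains $\Omega_k$, $k=1,\dots,K$, and set $V^1=H_0(\operatorname{curl};\Omega)$, $V^2=H_0(\operatorname{div};\Omega)$. For each $k$ let $V^1_h(\Omega_k)\subset H(\operatorname{curl};\Omega_k)$ and $V^2_h(\Omega_k)\subset H(\operatorname{div};\Omega_k)$ be finite-dimensional spaces (no boundary conditions) with $\operatorname{curl}V^1_h(\Omega_k)\subset V^2_h(\Omega_k)$. The broken spaces are $$V^\ell_h:=\{v\in L^2(\Omega)^3: v|_{\Omega_k}\in V^\ell_h(\Omega_k),\ k=1,\dots,K\},\quad \ell=1,2,$$ and the conforming spaces are $V^{\ell,c}_h:=V^\ell_h\cap V^\ell$; one has $\operatorname{curl}V^{1,c}_h\subset V^{2,c}_h$. The conforming projection $P^1_h:V^1_h\to V^1_h$ is a linear projection with range $V^{1,c}_h$. Operators: - $\operatorname{curl}_h:=\operatorname{curl}P^1_h:V^1_h\to V^2_h$, and $\widetilde{\operatorname{curl}}_h:V^2_h\to V^1_h$ is its $L^2$-adjoint: $\langle\widetilde{\operatorname{curl}}_hw,v\rangle=\langle w,\operatorname{curl}P^1_hv\rangle$ for all $w\in V^2_h$, $v\in V^1_h$. - $\operatorname{curl}^c_h:=\operatorname{curl}|_{V^{1,c}_h}:V^{1,c}_h\to V^{2,c}_h$, and $\widetilde{\operatorname{curl}}^c_h:V^{2,c}_h\to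 V^{1,c}_h$ is its $L^2$-adjoint. - $S^1_h:=(I-P^1_h)^*(I-P^1_h)$. - $\tilde\Pi^1_h:L^2(\Omega)^3\to V^1_h$ is defined by $\langle\tilde\Pi^1_hJ,v\rangle=\langle J,P^1_hv\rangle$ for all $v\in V^1_h$. *)

theory Defs
  imports "HOL-Analysis.Analysis"
begin

section \<open>The Hilbert space of square-integrable fields\<close>

definition square_integrable :: "('a::euclidean_space \<Rightarrow> 'b::euclidean_space) \<Rightarrow> bool" where
  "square_integrable f \<longleftrightarrow>
     f \<in> borel_measurable lborel \<and> integrable lborel (\<lambda>x. (norm (f x))\<^sup>2)"

definition l2rel :: "('a::euclidean_space \<Rightarrow> 'b::euclidean_space) \<Rightarrow> ('a \<Rightarrow> 'b) \<Rightarrow> bool" where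
  "l2rel f g \<longleftrightarrow> square_integrable f \<and> square_integrable g \<and> (AE x in lborel. f x = g x)"

lemma square_integrable_zero [simp]: "square_integrable (\<lambda>x. 0)"
  by (simp add: square_integrable_def)

lemma square_integrable_add:
  assumes "square_integrable f" "square_integrable g"
  shows "square_integrable (\<lambda>x. f x + g x)"
proof -
  have [measurable]: "f \<in> borel_measurable borel" "g \<in> borel_measurable borel"
    using assms by (auto simp: square_integrable_def)
  have "integrable lborel (\<lambda>x. (norm (f x + g x))\<^sup>2)"
  proof (rule Bochner_Integration.integrable_bound)
    show "integrable lborel (\<lambda>x. 2 * (norm (f x))\<^sup>2 + 2 * (norm (g x))\<^sup>2)"
      using assms by (auto simp: square_integrable_def)
    show "AE x in lborel. norm ((norm (f x + g x))\<^sup>2)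
            \<le> norm (2 * (norm (f x))\<^sup>2 + 2 * (norm (g x))\<^sup>2)"
    proof (rule AE_I2)
      fix x
      have "(norm (f x + g x))\<^sup>2 \<le> (norm (f x) + norm (g x))\<^sup>2"
        by (simp add: norm_triangle_ineq power_mono)
      also have "\<dots> \<le> 2 * (norm (f x))\<^sup>2 + 2 * (norm (g x))\<^sup>2"
        using sum_squares_bound[of "norm (f x)" "norm (g x)"]
        by (simp add: power2_sum)
      finally show "norm ((norm (f x + g x))\<^sup>2)
            \<le> norm (2 * (norm (f x))\<^sup>2 + 2 * (norm (g x))\<^sup>2)" by simp
    qed
  qed simp
  then show ?thesis by (simp add: square_integrable_def)
qed

lemma square_integrable_scaleR:
  assumes "square_integrable f"
  shows "square_integrable (\<lambda>x. c *\<^sub>R f x)"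
  using assms by (auto simp: square_integrable_def power_mult_distrib)

lemma square_integrable_uminus:
  assumes "square_integrable f"
  shows "square_integrable (\<lambda>x. - f x)"
  using square_integrable_scaleR[OF assms, of "-1"] by simp

lemma square_integrable_diff:
  assumes "square_integrable f" "square_integrable g"
  shows "square_integrable (\<lambda>x. f x - g x)"
  using square_integrable_add[OF assms(1) square_integrable_uminus[OF assms(2)]] by simp

lemma square_integrable_inner:
  assumes "square_integrable f" "square_integrable g"
  shows "integrable lborel (\<lambda>x. f x \<bullet> g x)"
proof (rule Bochner_Integration.integrable_bound)
  have [measurable]: "f \<in> borel_measurable borel" "g \<in> borel_measurable borel"
    using assms by (auto simp: square_integrable_def)
  show "(\<lambda>x. f x \<bullet> g x) \<in> borel_measurable lborel" by simp
  show "integrable lborel (\<lambda>x. (norm (f x))\<^sup>2 + (norm (g x))\<^sup>2)"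
    using assms by (auto simp: square_integrable_def)
  show "AE x in lborel. norm (f x \<bullet> g x) \<le> norm ((norm (f x))\<^sup>2 + (norm (g x))\<^sup>2)"
  proof (rule AE_I2)
    fix x
    have "\<bar>f x \<bullet> g x\<bar> \<le> norm (f x) * norm (g x)" by (rule Cauchy_Schwarz_ineq2)
    also have "\<dots> \<le> (norm (f x))\<^sup>2 + (norm (g x))\<^sup>2"
      using sum_squares_bound[of "norm (f x)" "norm (g x)"]
        mult_nonneg_nonneg[of "norm (f x)" "norm (g x)"] by (simp del: mult_nonneg_nonneg; linarith)
    finally show "norm (f x \<bullet> g x) \<le> norm ((norm (f x))\<^sup>2 + (norm (g x))\<^sup>2)" by simp
  qed
qed

text \<open>
  Square-integrable fields on the whole space modulo almost-everywhere equality. The space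
  of such fields on a subset is identified below, by zero extension, with the
  subspace of classes vanishing almost everywhere outside that subset. Here \<open>abs_l2 f\<close> is
  the class of a square-integrable function and \<open>rep_l2 u\<close> some representative of a class.
\<close>

quotient_type (overloaded) ('a, 'b) l2 =
  "'a::euclidean_space \<Rightarrow> 'b::euclidean_space" / partial: l2rel
proof (rule part_equivpI)
  show "\<exists>f::'a \<Rightarrow> 'b. l2rel f f"
    by (rule exI[of _ "\<lambda>x. 0"]) (simp add: l2rel_def)
  show "symp (l2rel :: ('a \<Rightarrow> 'b) \<Rightarrow> _)"
    by (auto simp: symp_def l2rel_def)
  show "transp (l2rel :: ('a \<Rightarrow> 'b) \<Rightarrow> _)"
    unfolding transp_def l2rel_def by (auto elim: eventually_elim2)
qed

instantiation l2 :: (euclidean_space, euclidean_space) real_vector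
begin

lift_definition zero_l2 :: "('a, 'b) l2" is "\<lambda>x. 0"
  by (simp add: l2rel_def)

lift_definition plus_l2 :: "('a, 'b) l2 \<Rightarrow> ('a, 'b) l2 \<Rightarrow> ('a, 'b) l2" is "\<lambda>f g x. f x + g x"
  unfolding l2rel_def by (auto intro: square_integrable_add elim: eventually_elim2)

lift_definition uminus_l2 :: "('a, 'b) l2 \<Rightarrow> ('a, 'b) l2" is "\<lambda>f x. - f x"
  unfolding l2rel_def by (auto intro: square_integrable_uminus elim: eventually_mono)

lift_definition minus_l2 :: "('a, 'b) l2 \<Rightarrow> ('a, 'b) l2 \<Rightarrow> ('a, 'b) l2" is "\<lambda>f g x. f x - g x"
  unfolding l2rel_def by (auto intro: square_integrable_diff elim: eventually_elim2)

lift_definition scaleR_l2 :: "real \<Rightarrow> ('a, 'b) l2 \<Rightarrow> ('a, 'b) l2" is "\<lambda>c f x. c *\<^sub>R f x"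
  unfolding l2rel_def by (auto intro: square_integrable_scaleR elim: eventually_mono)

instance
proof
  fix u v w :: "('a, 'b) l2" and a b :: real
  show "u + v + w = u + (v + w)"
    by transfer (auto simp: l2rel_def add.assoc intro!: square_integrable_add)
  show "u + v = v + u"
    by transfer (auto simp: l2rel_def add.commute intro!: square_integrable_add)
  show "0 + u = u"
    by transfer (auto simp: l2rel_def)
  show "- u + u = 0"
    by transfer (auto simp: l2rel_def)
  show "u - v = u + - v"
    by transfer (auto simp: l2rel_def intro!: square_integrable_diff)
  show "a *\<^sub>R (u + v) = a *\<^sub>R u + a *\<^sub>R v"
    by transfer (auto simp: l2rel_def scaleR_add_right
        intro!: square_integrable_add square_integrable_scaleR)
  show "(a + b) *\<^sub>R u = a *\<^sub>R u + b *\<^sub>R u"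
    by transfer (auto simp: l2rel_def scaleR_add_left
        intro!: square_integrable_add square_integrable_scaleR)
  show "a *\<^sub>R b *\<^sub>R u = (a * b) *\<^sub>R u"
    by transfer (auto simp: l2rel_def intro!: square_integrable_scaleR)
  show "1 *\<^sub>R u = u"
    by transfer (auto simp: l2rel_def)
qed

end

instantiation l2 :: (euclidean_space, euclidean_space) real_inner
begin

lift_definition inner_l2 :: "('a, 'b) l2 \<Rightarrow> ('a, 'b) l2 \<Rightarrow> real" is
  "\<lambda>f g. \<integral>x. f x \<bullet> g x \<partial>lborel"
proof -
  fix f f' g g' :: "'a \<Rightarrow> 'b"
  assume fg: "l2rel f f'" "l2rel g g'"
  then have "AE x in lborel. f x \<bullet> g x = f' x \<bullet> g' x"
    unfolding l2rel_def by (auto elim: eventually_elim2)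
  with fg show "(\<integral>x. f x \<bullet> g x \<partial>lborel) = (\<integral>x. f' x \<bullet> g' x \<partial>lborel)"
    by (intro integral_cong_AE) (auto simp: l2rel_def square_integrable_def)
qed

definition norm_l2 :: "('a, 'b) l2 \<Rightarrow> real" where
  "norm_l2 u = sqrt (inner u u)"

definition sgn_l2 :: "('a, 'b) l2 \<Rightarrow> ('a, 'b) l2" where
  "sgn_l2 u = u /\<^sub>R norm u"

definition dist_l2 :: "('a, 'b) l2 \<Rightarrow> ('a, 'b) l2 \<Rightarrow> real" where
  "dist_l2 u v = norm (u - v)"

definition uniformity_l2 :: "(('a, 'b) l2 \<times> ('a, 'b) l2) filter" where
  "uniformity_l2 = (INF e\<in>{0<..}. principal {(u, v). dist u v < e})"

definition open_l2 :: "('a, 'b) l2 set \<Rightarrow> bool" where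
  "open_l2 U \<longleftrightarrow> (\<forall>u\<in>U. eventually (\<lambda>(u', v). u' = u \<longrightarrow> v \<in> U) uniformity)"

instance
proof
  fix u v w :: "('a, 'b) l2" and r :: real
  show "dist u v = norm (u - v)" by (rule dist_l2_def)
  show "sgn u = u /\<^sub>R norm u" by (rule sgn_l2_def)
  show "uniformity = (INF e\<in>{0<..}. principal {(u::('a, 'b) l2, v). dist u v < e})"
    by (rule uniformity_l2_def)
  show "open U \<longleftrightarrow> (\<forall>u\<in>U. eventually (\<lambda>(u', v). u' = u \<longrightarrow> v \<in> U) uniformity)"
    for U :: "('a, 'b) l2 set" by (rule open_l2_def)
  show "inner u v = inner v u"
    by transfer (simp add: inner_commute)
  show "inner (u + v) w = inner u w + inner v w"
    by transfer (simp add: l2rel_def inner_add_left square_integrable_inner)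
  show "inner (r *\<^sub>R u) v = r * inner u v"
    by transfer simp
  show "0 \<le> inner u u"
    by transfer simp
  show "inner u u = 0 \<longleftrightarrow> u = 0"
  proof transfer
    fix f :: "'a \<Rightarrow> 'b"
    assume "l2rel f f"
    then have f: "square_integrable f" by (simp add: l2rel_def)
    have "(\<integral>x. f x \<bullet> f x \<partial>lborel) = 0 \<longleftrightarrow> (AE x in lborel. f x \<bullet> f x = 0)"
      by (rule integral_nonneg_eq_0_iff_AE[OF square_integrable_inner[OF f f]]) simp
    with f show "(\<integral>x. f x \<bullet> f x \<partial>lborel) = 0 \<longleftrightarrow> l2rel f (\<lambda>x. 0)"
      by (simp add: l2rel_def)
  qed
  show "norm u = sqrt (inner u u)" by (rule norm_l2_def)
qed

end

definition L2 :: "'a::euclidean_space set \<Rightarrow> ('a, 'b::euclidean_space) l2 set" where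
  "L2 U = {u. AE x in lborel. x \<notin> U \<longrightarrow> rep_l2 u x = 0}"

definition restr :: "'a::euclidean_space set \<Rightarrow> ('a, 'b::euclidean_space) l2 \<Rightarrow> ('a, 'b) l2" where
  "restr U u = abs_l2 (\<lambda>x. indicator U x *\<^sub>R rep_l2 u x)"

section \<open>Test functions and the classical operators of vector calculus\<close>

definition partial_deriv :: "'n \<Rightarrow> (real^'n \<Rightarrow> 'b::euclidean_space) \<Rightarrow> real^'n \<Rightarrow> 'b" where
  "partial_deriv j f x = frechet_derivative f (at x) (axis j 1)"

primrec C_k :: "nat \<Rightarrow> (real^'n \<Rightarrow> 'b::euclidean_space) \<Rightarrow> bool" where
  "C_k 0 f \<longleftrightarrow> continuous_on UNIV f"
| "C_k (Suc k) f \<longleftrightarrow> (\<forall>x. f differentiable (at x)) \<and> (\<forall>j. C_k k (partial_deriv j f))"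

definition test_functions :: "(real^'n) set \<Rightarrow> (real^'n \<Rightarrow> 'b::euclidean_space) set" where
  "test_functions U =
     {\<phi>. (\<forall>k. C_k k \<phi>) \<and> compact (closure {x. \<phi> x \<noteq> 0}) \<and> closure {x. \<phi> x \<noteq> 0} \<subseteq> U}"

definition classical_curl :: "(real^3 \<Rightarrow> real^3) \<Rightarrow> real^3 \<Rightarrow> real^3" where
  "classical_curl \<phi> x = vector
     [partial_deriv 2 \<phi> x $ 3 - partial_deriv 3 \<phi> x $ 2,
      partial_deriv 3 \<phi> x $ 1 - partial_deriv 1 \<phi> x $ 3,
      partial_deriv 1 \<phi> x $ 2 - partial_deriv 2 \<phi> x $ 1]"

definition classical_div :: "(real^3 \<Rightarrow> real^3) \<Rightarrow> real^3 \<Rightarrow> real" where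
  "classical_div \<phi> x = (\<Sum>j\<in>UNIV. partial_deriv j \<phi> x $ j)"

definition classical_grad :: "(real^3 \<Rightarrow> real) \<Rightarrow> real^3 \<Rightarrow> real^3" where
  "classical_grad \<psi> x = (\<chi> j. partial_deriv j \<psi> x)"

section \<open>The spaces H(curl) and H(div)\<close>

text \<open>
  Distributional curl and divergence. For an open set \<open>U\<close> they are unique when they exist,
  by density of the test functions, so the definite descriptions below are meaningful on
  \<open>Hcurl U\<close> and \<open>Hdiv U\<close>.
\<close>

type_synonym vfield = "(real^3, real^3) l2"
type_synonym sfield = "(real^3, real) l2"

definition has_weak_curl :: "(real^3) set \<Rightarrow> vfield \<Rightarrow> vfield \<Rightarrow> bool" where
  "has_weak_curl U u w \<longleftrightarrow> w \<in> L2 U \<and>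
     (\<forall>\<phi>\<in>test_functions U. u \<bullet> abs_l2 (classical_curl \<phi>) = w \<bullet> abs_l2 \<phi>)"

definition Hcurl :: "(real^3) set \<Rightarrow> vfield set" where
  "Hcurl U = {u \<in> L2 U. \<exists>w. has_weak_curl U u w}"

definition curl :: "(real^3) set \<Rightarrow> vfield \<Rightarrow> vfield" where
  "curl U u = (THE w. has_weak_curl U u w)"

definition has_weak_div :: "(real^3) set \<Rightarrow> vfield \<Rightarrow> sfield \<Rightarrow> bool" where
  "has_weak_div U u g \<longleftrightarrow> g \<in> L2 U \<and>
     (\<forall>\<psi>\<in>test_functions U. u \<bullet> abs_l2 (classical_grad \<psi>) = - (g \<bullet> abs_l2 \<psi>))"

definition Hdiv :: "(real^3) set \<Rightarrow> vfield set" where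
  "Hdiv U = {u \<in> L2 U. \<exists>g. has_weak_div U u g}"

definition weak_div :: "(real^3) set \<Rightarrow> vfield \<Rightarrow> sfield" where
  "weak_div U u = (THE g. has_weak_div U u g)"

text \<open>
  The spaces with vanishing tangential, respectively normal, trace are the closures of the
  test fields in the graph norms; no regularity of the boundary is needed for this.
\<close>

definition H0curl :: "(real^3) set \<Rightarrow> vfield set" where
  "H0curl U = {u \<in> Hcurl U. \<forall>e>0. \<exists>\<phi>\<in>test_functions U.
     norm (u - abs_l2 \<phi>) < e \<and> norm (curl U u - abs_l2 (classical_curl \<phi>)) < e}"

definition H0div :: "(real^3) set \<Rightarrow> vfield set" where
  "H0div U = {u \<in> Hdiv U. \<forall>e>0. \<exists>\<phi>\<in>test_functions U.
     norm (u - abs_l2 \<phi>) < e \<and> norm (weak_div U u - abs_l2 (classical_div \<phi>)) < e}"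

section \<open>Linear operators between finite-dimensional subspaces\<close>

definition finite_dim_subspace :: "'a::real_vector set \<Rightarrow> bool" where
  "finite_dim_subspace V \<longleftrightarrow> (\<exists>B. finite B \<and> V = span B)"

definition linear_map_on :: "'a::real_vector set \<Rightarrow> 'b::real_vector set \<Rightarrow> ('a \<Rightarrow> 'b) \<Rightarrow> bool" where
  "linear_map_on V W A \<longleftrightarrow> A ` V \<subseteq> W \<and>
     (\<forall>u\<in>V. \<forall>v\<in>V. A (u + v) = A u + A v) \<and> (\<forall>c. \<forall>v\<in>V. A (c *\<^sub>R v) = c *\<^sub>R A v)"

text \<open>Operators are only meaningful on their domain; in particular \<^term>\<open>adjoint_on V W A\<close>,
  the adjoint of an operator from \<^term>\<open>V\<close> to \<^term>\<open>W\<close>, is specified on \<^term>\<open>W\<close> only.\<close>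

definition adjoint_on ::
  "'a::real_inner set \<Rightarrow> 'b::real_inner set \<Rightarrow> ('a \<Rightarrow> 'b) \<Rightarrow> 'b \<Rightarrow> 'a" where
  "adjoint_on V W A =
     (SOME A'. A' ` W \<subseteq> V \<and> (\<forall>w\<in>W. \<forall>v\<in>V. A' w \<bullet> v = w \<bullet> A v))"

definition eigenvalue_on :: "'a::real_vector set \<Rightarrow> ('a \<Rightarrow> 'a) \<Rightarrow> real \<Rightarrow> bool" where
  "eigenvalue_on V A l \<longleftrightarrow> (\<exists>v\<in>V. v \<noteq> 0 \<and> A v = l *\<^sub>R v)"

section \<open>Broken and conforming spaces\<close>

definition domain :: "(real^3) set \<Rightarrow> bool" where
  "domain U \<longleftrightarrow> open U \<and> connected U \<and> U \<noteq> {}"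

text \<open>As usual for open subdomains, a partition leaves out a null set (the interfaces).\<close>

definition domain_partition :: "(real^3) set \<Rightarrow> nat \<Rightarrow> (nat \<Rightarrow> (real^3) set) \<Rightarrow> bool" where
  "domain_partition \<Omega> K \<Omega>s \<longleftrightarrow>
     domain \<Omega> \<and> (\<forall>k\<in>{1..K}. domain (\<Omega>s k) \<and> \<Omega>s k \<subseteq> \<Omega>) \<and>
     disjoint_family_on \<Omega>s {1..K} \<and> negligible (\<Omega> - (\<Union>k\<in>{1..K}. \<Omega>s k))"

definition broken_space ::
  "(real^3) set \<Rightarrow> nat \<Rightarrow> (nat \<Rightarrow> (real^3) set) \<Rightarrow> (nat \<Rightarrow> vfield set) \<Rightarrow> vfield set" where
  "broken_space \<Omega> K \<Omega>s Vs = {v \<in> L2 \<Omega>. \<forall>k\<in>{1..K}. restr (\<Omega>s k) v \<in> Vs k}"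

definition conforming_projection :: "vfield set \<Rightarrow> vfield set \<Rightarrow> (vfield \<Rightarrow> vfield) \<Rightarrow> bool" where
  "conforming_projection V Vc P \<longleftrightarrow>
     linear_map_on V V P \<and> (\<forall>v\<in>V. P (P v) = P v) \<and> P ` V = Vc"

section \<open>The discrete operators and the two discrete problems\<close>

text \<open>In the following, \<open>V1\<close>, \<open>V2\<close> are the broken spaces and \<open>V1c\<close>, \<open>V2c\<close> the conforming ones.\<close>

definition curl_h :: "(real^3) set \<Rightarrow> (vfield \<Rightarrow> vfield) \<Rightarrow> vfield \<Rightarrow> vfield" where
  "curl_h \<Omega> P v = curl \<Omega> (P v)"

definition curlt_h ::
  "(real^3) set \<Rightarrow> vfield set \<Rightarrow> vfield set \<Rightarrow> (vfield \<Rightarrow> vfield) \<Rightarrow> vfield \<Rightarrow> vfield" where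
  "curlt_h \<Omega> V1 V2 P = adjoint_on V1 V2 (curl_h \<Omega> P)"

definition curlt_c :: "(real^3) set \<Rightarrow> vfield set \<Rightarrow> vfield set \<Rightarrow> vfield \<Rightarrow> vfield" where
  "curlt_c \<Omega> V1c V2c = adjoint_on V1c V2c (curl \<Omega>)"

definition jump_stab :: "vfield set \<Rightarrow> (vfield \<Rightarrow> vfield) \<Rightarrow> vfield \<Rightarrow> vfield" where
  "jump_stab V1 P v = adjoint_on V1 V1 (\<lambda>u. u - P u) (v - P v)"

definition source_proj :: "vfield set \<Rightarrow> (vfield \<Rightarrow> vfield) \<Rightarrow> vfield \<Rightarrow> vfield" where
  "source_proj V1 P J = (THE z. z \<in> V1 \<and> (\<forall>v\<in>V1. z \<bullet> v = J \<bullet> P v))"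

definition nonconforming_solution ::
  "(real^3) set \<Rightarrow> vfield set \<Rightarrow> vfield set \<Rightarrow> (vfield \<Rightarrow> vfield) \<Rightarrow> real \<Rightarrow> real \<Rightarrow> vfield
     \<Rightarrow> vfield \<Rightarrow> bool" where
  "nonconforming_solution \<Omega> V1 V2 P \<omega> \<alpha> J u \<longleftrightarrow> u \<in> V1 \<and>
     - (\<omega>\<^sup>2 *\<^sub>R adjoint_on V1 V1 P (P u)) + curlt_h \<Omega> V1 V2 P (curl_h \<Omega> P u)
       + \<alpha> *\<^sub>R jump_stab V1 P u = source_proj V1 P J"

definition conforming_solution ::
  "(real^3) set \<Rightarrow> vfield set \<Rightarrow> real \<Rightarrow> vfield \<Rightarrow> vfield \<Rightarrow> bool" where
  "conforming_solution \<Omega> V1c \<omega> J u \<longleftrightarrow> u \<in> V1c \<and>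
     (\<forall>v\<in>V1c. - \<omega>\<^sup>2 * (v \<bullet> u) + curl \<Omega> v \<bullet> curl \<Omega> u = v \<bullet> J)"

end

(* Tested with v - P v, the stabilized equation forces u = P u, because the terms that see only
   P v drop out and alpha is nonzero; tested with conforming v it is the conforming problem.
   Conversely a conforming solution satisfies u = P u. So both problems have the same solutions,
   and the conforming one is uniquely solvable because the symmetric operator
   curlt_c curl - omega^2 is injective on a finite-dimensional space.
   For the adjoints to be meaningful, the weak curl must be well defined, hence linear (density of
   test functions in L^2), local (so curl V1c lies in V2), and must map H0(curl) into H0(div)
   (from div curl = 0 and curl grad = 0, i.e. symmetry of second derivatives). *)
theory Submission
  imports Defs
begin

section \<open>Linear maps on finite-dimensional subspaces\<close>

text \<open>Operators are total functions that mean something only on a subspace, so linearity,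
  Riesz representation and the rank argument are all needed relative to a carrier set. Adjoints are
  chosen by \<open>SOME\<close> and specified only on their domain: an equation containing one
  becomes usable once its argument is known to lie there, and then only by testing with vectors of
  the carrier. Hence operator equations are handled in weak form, and even the linearity of a
  composite with an adjoint is checked that way. The analytic obstacle is uniqueness of the weak
  curl on an arbitrary open set. Instead of mollifying, products of one-dimensional profiles built
  from exp(-1/t) are made to converge to indicators of boxes; boxes generate the Borel sets, and
  countably many of them exhaust the open set. Finite dimension of the broken space is also
  something to derive: it rests on the interfaces being null sets, so that a field is the sum of its
  restrictions.\<close>

lemma finite_dim_subspace_subspace: "finite_dim_subspace V \<Longrightarrow> subspace V"
  by (auto simp: finite_dim_subspace_def)

text \<open>An independent set inside the span of a finite set is finite, so a maximal independent
  subset of \<open>V\<close> is a finite spanning set. This serves spaces that are only known to sit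
  inside a finite-dimensional one.\<close>

lemma finite_dim_subspaceI:
  assumes V: "subspace V" and B: "finite B" "V \<subseteq> span B"
  shows "finite_dim_subspace V"
proof -
  obtain C where C: "C \<subseteq> V" "independent C" "V \<subseteq> span C"
    using maximal_independent_subset by blast
  have "finite C"
    using independent_span_bound[OF B(1) C(2)] B(2) C(1) by blast
  moreover have "span C = V"
    using C V by (meson span_minimal subset_antisym)
  ultimately show ?thesis by (auto simp: finite_dim_subspace_def)
qed

lemma linear_map_onD:
  assumes "linear_map_on V W A"
  shows "v \<in> V \<Longrightarrow> A v \<in> W" "u \<in> V \<Longrightarrow> v \<in> V \<Longrightarrow> A (u + v) = A u + A v"
    "v \<in> V \<Longrightarrow> A (c *\<^sub>R v) = c *\<^sub>R A v"
  using assms by (auto simp: linear_map_on_def)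

lemma linear_map_on_diff:
  assumes "subspace V" "linear_map_on V W A" "u \<in> V" "v \<in> V"
  shows "A (u - v) = A u - A v"
proof -
  have "A (u + (-1) *\<^sub>R v) = A u + A ((-1) *\<^sub>R v)"
    using assms by (meson linear_map_onD(2) subspace_scale)
  with assms(2,4) show ?thesis by (simp only: linear_map_onD(3)) simp
qed

lemma linear_map_on_sum:
  assumes "subspace V" "linear_map_on V W A" "\<And>i. i \<in> I \<Longrightarrow> v i \<in> V"
  shows "A (\<Sum>i\<in>I. v i) = (\<Sum>i\<in>I. A (v i))"
proof -
  have "A 0 = 0"
    using linear_map_on_diff[OF assms(1,2), of 0 0] subspace_0[OF assms(1)] by simp
  then show ?thesis
    using assms(3)
    by (induction I rule: infinite_finite_induct)
       (auto simp: linear_map_onD(2)[OF assms(2)] subspace_sum[OF assms(1)])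
qed

lemma subspace_linear_map_on_image:
  assumes "subspace V" "linear_map_on V W A"
  shows "subspace (A ` V)"
  unfolding subspace_def
proof (intro conjI ballI allI)
  show "0 \<in> A ` V"
    using linear_map_on_diff[OF assms, of 0 0] subspace_0[OF assms(1)] by force
next
  fix x y assume "x \<in> A ` V" "y \<in> A ` V"
  then obtain u v where "u \<in> V" "v \<in> V" "x = A u" "y = A v" by blast
  then show "x + y \<in> A ` V"
    using linear_map_onD(2)[OF assms(2)] subspace_add[OF assms(1)] by (metis imageI)
next
  fix c :: real and x assume "x \<in> A ` V"
  then obtain u where "u \<in> V" "x = A u" by blast
  then show "c *\<^sub>R x \<in> A ` V"
    using linear_map_onD(3)[OF assms(2)] subspace_scale[OF assms(1)] by (metis imageI)
qed

text \<open>In an orthogonal spanning set the representative is given explicitly by its Fourier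
  coefficients; completeness of the ambient space does not enter.\<close>

lemma riesz_on:
  fixes V :: "'a::real_inner set"
  assumes V: "finite_dim_subspace V" and F: "linear_map_on V (UNIV :: real set) F"
  shows "\<exists>!z. z \<in> V \<and> (\<forall>v\<in>V. z \<bullet> v = F v)"
proof (rule ex_ex1I)
  obtain B where B: "finite B" "V = span B" using V by (auto simp: finite_dim_subspace_def)
  obtain C where C: "finite C" "span C = V" "pairwise orthogonal C"
    using basis_orthogonal[OF B(1)] B(2) by metis
  have sub: "subspace V" by (rule finite_dim_subspace_subspace[OF V])
  define z where "z = (\<Sum>c\<in>C. (F c / (c \<bullet> c)) *\<^sub>R c)"
  have CV: "C \<subseteq> V" using C(2) span_superset by blast
  have F0: "F 0 = 0" using linear_map_onD(3)[OF F subspace_0[OF sub], of 0] by simp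
  have zc: "z \<bullet> c = F c" if "c \<in> C" for c
  proof -
    have "z \<bullet> c = (\<Sum>d\<in>C. if d = c then F c / (c \<bullet> c) * (c \<bullet> c) else 0)"
      unfolding z_def inner_sum_left using C(3) that
      by (intro sum.cong) (auto simp: pairwise_def orthogonal_def)
    \<comment> \<open>The orthogonal spanning set may contain the zero vector; its coefficient is 0
      by the convention for division by zero, and \<open>F 0 = 0\<close> matches.\<close>
    also have "\<dots> = F c" using C(1) that F0 by (cases "c = 0") auto
    finally show ?thesis .
  qed
  have "z \<bullet> v = F v" if "v \<in> V" for v
  proof -
    have "v \<in> span C" using that C(2) by simp
    then obtain u where v: "v = (\<Sum>c\<in>C. u c *\<^sub>R c)"
      unfolding span_finite[OF C(1)] by blast
    have "F v = (\<Sum>c\<in>C. F (u c *\<^sub>R c))"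
      unfolding v using CV by (intro linear_map_on_sum[OF sub F]) (auto intro: subspace_scale[OF sub])
    also have "\<dots> = (\<Sum>c\<in>C. u c * F c)"
      using CV linear_map_onD(3)[OF F] by (intro sum.cong) auto
    also have "\<dots> = z \<bullet> v" unfolding v inner_sum_right by (simp add: zc)
    finally show ?thesis by simp
  qed
  moreover have "z \<in> V"
    unfolding z_def using CV by (intro subspace_sum[OF sub] subspace_scale[OF sub]) auto
  ultimately show "\<exists>z. z \<in> V \<and> (\<forall>v\<in>V. z \<bullet> v = F v)" by blast
next
  fix y z assume "y \<in> V \<and> (\<forall>v\<in>V. y \<bullet> v = F v)" "z \<in> V \<and> (\<forall>v\<in>V. z \<bullet> v = F v)"
  moreover from this have "y - z \<in> V"
    using finite_dim_subspace_subspace[OF V] by (auto intro: subspace_diff)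
  ultimately have "(y - z) \<bullet> (y - z) = 0" by (simp add: inner_diff_left)
  then show "y = z" by simp
qed

text \<open>Riesz representation of the functional sending \<open>v\<close> to the inner product of
  \<open>w\<close> with \<open>A v\<close>, for each \<open>w\<close>, shows that the choice in the
  definition is inhabited. Nothing can be said for \<open>w\<close> outside \<open>W\<close>, whence
  the premise.\<close>

lemma adjoint_on:
  fixes V :: "'a::real_inner set" and W :: "'b::real_inner set"
  assumes V: "finite_dim_subspace V" and A: "linear_map_on V U A"
  shows "w \<in> W \<Longrightarrow> adjoint_on V W A w \<in> V"
    and "w \<in> W \<Longrightarrow> v \<in> V \<Longrightarrow> adjoint_on V W A w \<bullet> v = w \<bullet> A v"
proof -
  have "linear_map_on V UNIV (\<lambda>v. w \<bullet> A v)" for w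
    using A by (auto simp: linear_map_on_def inner_add_right)
  from riesz_on[OF V this] obtain A' where "\<And>w. A' w \<in> V \<and> (\<forall>v\<in>V. A' w \<bullet> v = w \<bullet> A v)"
    by metis
  then have "A' ` W \<subseteq> V \<and> (\<forall>w\<in>W. \<forall>v\<in>V. A' w \<bullet> v = w \<bullet> A v)" by blast
  then have "adjoint_on V W A ` W \<subseteq> V \<and> (\<forall>w\<in>W. \<forall>v\<in>V. adjoint_on V W A w \<bullet> v = w \<bullet> A v)"
    unfolding adjoint_on_def by (rule someI[where P = "\<lambda>A'. A' ` W \<subseteq> V \<and> (\<forall>w\<in>W. \<forall>v\<in>V. A' w \<bullet> v = w \<bullet> A v)"])
  then show "w \<in> W \<Longrightarrow> adjoint_on V W A w \<in> V"
    "w \<in> W \<Longrightarrow> v \<in> V \<Longrightarrow> adjoint_on V W A w \<bullet> v = w \<bullet> A v" by auto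
qed

text \<open>Testing with the difference \<open>y - z\<close> itself. This is the bridge between
  operator equations and their weak forms.\<close>

lemma eq_on_subspaceI:
  fixes V :: "'a::real_inner set"
  assumes "subspace V" "y \<in> V" "z \<in> V" "\<And>v. v \<in> V \<Longrightarrow> y \<bullet> v = z \<bullet> v"
  shows "y = z"
proof -
  have "(y - z) \<bullet> (y - z) = 0"
    using assms by (simp add: inner_diff_left subspace_diff)
  then show ?thesis by simp
qed

text \<open>Dimension count: the image of a basis is independent with the same number of elements,
  and a vector of \<open>V\<close> outside its span would produce an independent set larger than the
  basis.\<close>

lemma injective_imp_surjective_on:
  fixes V :: "'a::real_vector set"
  assumes V: "finite_dim_subspace V" and T: "linear_map_on V V T"
    and inj: "\<And>v. v \<in> V \<Longrightarrow> T v = 0 \<Longrightarrow> v = 0"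
  shows "T ` V = V"
proof
  show "T ` V \<subseteq> V" using linear_map_onD(1)[OF T] by blast
  have sub: "subspace V" by (rule finite_dim_subspace_subspace[OF V])
  obtain B where B: "B \<subseteq> V" "independent B" "V \<subseteq> span B"
    using maximal_independent_subset by blast
  have VB: "span B = V" using B sub by (meson span_minimal subset_antisym)
  have finB: "finite B"
    using V independent_span_bound[OF _ B(2)] B(1) by (auto simp: finite_dim_subspace_def)
  \<comment> \<open>\<open>T\<close> need not be linear outside \<open>V\<close>; a globally linear
    map agreeing with it on \<open>V\<close> makes the facts about \<open>linear\<close>
    applicable.\<close>
  obtain g where g: "linear g" "\<And>x. x \<in> B \<Longrightarrow> g x = T x"
    using linear_independent_extend[OF B(2), of T] by blast
  have gT: "g v = T v" if "v \<in> V" for v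
  proof -
    have "v \<in> span B" using that VB by simp
    then obtain u where v: "v = (\<Sum>c\<in>B. u c *\<^sub>R c)"
      unfolding span_finite[OF finB] by blast
    have "T v = (\<Sum>c\<in>B. T (u c *\<^sub>R c))"
      unfolding v using B(1) by (intro linear_map_on_sum[OF sub T]) (auto intro: subspace_scale[OF sub])
    also have "\<dots> = (\<Sum>c\<in>B. g (u c *\<^sub>R c))"
      using B(1) linear_map_onD(3)[OF T] g by (intro sum.cong) (auto simp: linear_scale subset_iff)
    also have "\<dots> = g v" unfolding v by (simp add: linear_sum[OF g(1)])
    finally show ?thesis by simp
  qed
  have injg: "inj_on g (span B)"
  proof (rule inj_onI)
    fix x y assume "x \<in> span B" "y \<in> span B" "g x = g y"
    then have "x - y \<in> V" "T (x - y) = 0"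
      using VB gT linear_map_on_diff[OF sub T, of x y] subspace_diff[OF sub] by auto
    then show "x = y" using inj by force
  qed
  have ind: "independent (g ` B)"
    by (rule linear_independent_injective_image[OF g(1) B(2) injg])
  have card: "card (g ` B) = card B"
    using injg by (intro card_image) (meson inj_on_subset span_superset)
  have gBV: "g ` B \<subseteq> V" using g(2) B(1) linear_map_onD(1)[OF T] by auto
  have "V \<subseteq> span (g ` B)"
  proof (rule ccontr)
    assume "\<not> V \<subseteq> span (g ` B)"
    then obtain v where v: "v \<in> V" "v \<notin> span (g ` B)" by blast
    then have "independent (insert v (g ` B))" using ind by (simp add: independent_insert)
    then have "card (insert v (g ` B)) \<le> card B"
      using independent_span_bound[OF finB] v(1) gBV VB by auto
    moreover have "v \<notin> g ` B" using v(2) span_base by metis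
    ultimately show False using card finB by simp
  qed
  also have "span (g ` B) = T ` V"
    using linear_span_image[OF g(1), of B] VB gT by auto
  finally show "V \<subseteq> T ` V" .
qed

section \<open>Functions of class C^k and test functions\<close>

lemma partial_deriv_eq:
  "(f has_derivative f') (at x) \<Longrightarrow> partial_deriv j f x = f' (axis j 1)"
  unfolding partial_deriv_def using frechet_derivative_at by metis

lemma partial_deriv_const [simp]: "partial_deriv j (\<lambda>x. c) = (\<lambda>x. 0)"
  by (simp add: partial_deriv_def fun_eq_iff)

lemma partial_deriv_bounded_linear:
  assumes "bounded_linear L" "f differentiable (at x)"
  shows "partial_deriv j (\<lambda>x. L (f x)) x = L (partial_deriv j f x)"
proof -
  have "((\<lambda>x. L (f x)) has_derivative (\<lambda>h. L (frechet_derivative f (at x) h))) (at x)"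
    using bounded_linear.has_derivative[OF assms(1)] assms(2) frechet_derivative_works by blast
  from partial_deriv_eq[OF this] show ?thesis by (simp add: partial_deriv_def)
qed

lemma partial_deriv_nth:
  "f differentiable (at x) \<Longrightarrow> partial_deriv j (\<lambda>x. f x $ i) x = partial_deriv j f x $ i"
  by (rule partial_deriv_bounded_linear) (rule bounded_linear_vec_nth)

lemma partial_deriv_add:
  assumes "f differentiable (at x)" "g differentiable (at x)"
  shows "partial_deriv j (\<lambda>x. f x + g x) x = partial_deriv j f x + partial_deriv j g x"
proof -
  have "((\<lambda>x. f x + g x) has_derivative
      (\<lambda>h. frechet_derivative f (at x) h + frechet_derivative g (at x) h)) (at x)"
    using assms by (intro has_derivative_add) (auto simp: frechet_derivative_works[symmetric])
  from partial_deriv_eq[OF this] show ?thesis by (simp add: partial_deriv_def)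
qed

lemma partial_deriv_diff:
  assumes "f differentiable (at x)" "g differentiable (at x)"
  shows "partial_deriv j (\<lambda>x. f x - g x) x = partial_deriv j f x - partial_deriv j g x"
proof -
  have "((\<lambda>x. f x - g x) has_derivative
      (\<lambda>h. frechet_derivative f (at x) h - frechet_derivative g (at x) h)) (at x)"
    using assms by (intro has_derivative_diff) (auto simp: frechet_derivative_works[symmetric])
  from partial_deriv_eq[OF this] show ?thesis by (simp add: partial_deriv_def)
qed

lemma partial_deriv_mult:
  fixes f g :: "real^'n \<Rightarrow> real"
  assumes "f differentiable (at x)" "g differentiable (at x)"
  shows "partial_deriv j (\<lambda>x. f x * g x) x = f x * partial_deriv j g x + partial_deriv j f x * g x"
proof -
  have "((\<lambda>x. f x * g x) has_derivative
      (\<lambda>h. f x * frechet_derivative g (at x) h + frechet_derivative f (at x) h * g x)) (at x)"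
    using assms by (intro has_derivative_mult) (auto simp: frechet_derivative_works[symmetric])
  from partial_deriv_eq[OF this] show ?thesis by (simp add: partial_deriv_def)
qed

section \<open>Closure properties of the classes \<open>C_k\<close>\<close>

lemma C_k_SucD: "C_k (Suc k) f \<Longrightarrow> C_k k f"
proof (induction k arbitrary: f)
  case 0
  then show ?case
    by (auto intro!: differentiable_imp_continuous_on simp: differentiable_on_def
        intro: differentiable_at_withinI)
next
  case (Suc k)
  then show ?case by simp
qed

lemma C_k_const [simp]: "C_k k (\<lambda>x. c)"
  by (induction k arbitrary: c) auto

lemma C_k_bounded_linear:
  assumes "bounded_linear L"
  shows "C_k k f \<Longrightarrow> C_k k (\<lambda>x. L (f x))"
proof (induction k arbitrary: f)
  case 0
  then show ?case using bounded_linear.continuous_on[OF assms] by auto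
next
  case (Suc k)
  have "partial_deriv j (\<lambda>x. L (f x)) = (\<lambda>x. L (partial_deriv j f x))" for j
    using Suc.prems by (intro ext partial_deriv_bounded_linear[OF assms]) simp
  moreover have "(\<lambda>x. L (f x)) differentiable (at x)" for x
    using Suc.prems bounded_linear.has_derivative[OF assms, of f "frechet_derivative f (at x)" "at x"]
      frechet_derivative_works[of f "at x"]
    unfolding C_k.simps by (meson differentiableI)
  ultimately show ?case using Suc by simp
qed

lemma C_k_nth: "C_k k f \<Longrightarrow> C_k k (\<lambda>x. f x $ i)"
  by (rule C_k_bounded_linear[OF bounded_linear_vec_nth])

lemma C_k_add: "C_k k f \<Longrightarrow> C_k k g \<Longrightarrow> C_k k (\<lambda>x. f x + g x)"
proof (induction k arbitrary: f g)
  case 0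
  then show ?case by (auto intro: continuous_on_add)
next
  case (Suc k)
  have "partial_deriv j (\<lambda>x. f x + g x) = (\<lambda>x. partial_deriv j f x + partial_deriv j g x)" for j
    using Suc.prems by (simp add: fun_eq_iff partial_deriv_add)
  then show ?case using Suc by (simp add: differentiable_add)
qed

lemma C_k_sum: "(\<And>i. i \<in> I \<Longrightarrow> C_k k (f i)) \<Longrightarrow> C_k k (\<lambda>x. \<Sum>i\<in>I. f i x)"
  by (induction I rule: infinite_finite_induct) (auto intro: C_k_add)

lemma C_k_diff:
  assumes "C_k k f" "C_k k g"
  shows "C_k k (\<lambda>x. f x - g x)"
  using C_k_add[OF assms(1) C_k_bounded_linear[OF bounded_linear_minus[OF bounded_linear_ident] assms(2)]]
  by simp

lemma C_k_mult:
  fixes f g :: "real^'n \<Rightarrow> real"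
  shows "C_k k f \<Longrightarrow> C_k k g \<Longrightarrow> C_k k (\<lambda>x. f x * g x)"
proof (induction k arbitrary: f g)
  case 0
  then show ?case by (auto intro: continuous_on_mult)
next
  case (Suc k)
  have "partial_deriv j (\<lambda>x. f x * g x) = (\<lambda>x. f x * partial_deriv j g x + partial_deriv j f x * g x)" for j
    using Suc.prems by (simp add: fun_eq_iff partial_deriv_mult)
  \<comment> \<open>The product rule leaves one factor undifferentiated, so the induction hypothesis
    is also needed for \<open>f\<close> and \<open>g\<close> themselves, one class lower.\<close>
  moreover have "C_k k f" "C_k k g" using Suc.prems C_k_SucD by blast+
  ultimately show ?case using Suc by (auto intro!: C_k_add)
qed

lemma C_k_prod:
  fixes f :: "'i \<Rightarrow> real^'n \<Rightarrow> real"
  shows "(\<And>i. i \<in> I \<Longrightarrow> C_k k (f i)) \<Longrightarrow> C_k k (\<lambda>x. \<Prod>i\<in>I. f i x)"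
  by (induction I rule: infinite_finite_induct) (auto intro: C_k_mult)

lemma C_k_scaleR_const: "C_k k f \<Longrightarrow> C_k k (\<lambda>x. f x *\<^sub>R c)"
  by (rule C_k_bounded_linear[OF bounded_linear_scaleR_left])

lemma C_k_vec:
  fixes f :: "'m::finite \<Rightarrow> real^'n \<Rightarrow> real"
  assumes "\<And>i. C_k k (f i)"
  shows "C_k k (\<lambda>x. \<chi> i. f i x)"
proof -
  have "(\<lambda>x. \<chi> i. f i x) = (\<lambda>x. \<Sum>i\<in>UNIV. f i x *\<^sub>R axis i 1)"
    by (auto simp: fun_eq_iff vec_eq_iff axis_def if_distrib cong: if_cong)
  then show ?thesis using assms by (simp add: C_k_sum C_k_scaleR_const)
qed

section \<open>Symmetry of second partial derivatives\<close>

lemma has_field_derivative_along_axis: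
  fixes f :: "real^'n \<Rightarrow> real"
  assumes "f differentiable (at (x + s *\<^sub>R axis i 1))"
  shows "((\<lambda>s. f (x + s *\<^sub>R axis i 1)) has_field_derivative partial_deriv i f (x + s *\<^sub>R axis i 1)) (at s within S)"
proof -
  have d: "((\<lambda>s. x + s *\<^sub>R axis i 1) has_derivative (\<lambda>h. h *\<^sub>R axis i 1)) (at s within S)"
    by (auto intro!: derivative_eq_intros)
  let ?f' = "frechet_derivative f (at (x + s *\<^sub>R axis i 1))"
  have "(f has_derivative ?f') (at (x + s *\<^sub>R axis i 1))"
    using assms frechet_derivative_works by blast
  then have "(f has_derivative ?f') (at (x + s *\<^sub>R axis i 1) within (\<lambda>s. x + s *\<^sub>R axis i 1) ` S)"
    by (rule has_derivative_at_withinI)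
  from diff_chain_within[OF d this]
  have "((\<lambda>s. f (x + s *\<^sub>R axis i 1)) has_derivative (\<lambda>h. ?f' (h *\<^sub>R axis i 1))) (at s within S)"
    by (simp add: o_def)
  moreover have "?f' (h *\<^sub>R axis i 1) = partial_deriv i f (x + s *\<^sub>R axis i 1) * h" for h
    using linear_scale[OF linear_frechet_derivative[OF assms], of h "axis i 1"]
    by (simp add: partial_deriv_def)
  ultimately show ?thesis by (simp add: has_field_derivative_def)
qed

text \<open>The left-hand side below is symmetric in \<open>i\<close> and \<open>j\<close>, which yields Schwarz's theorem as \<open>h \<rightarrow> 0\<close>.\<close>

lemma second_difference_eq_mixed_partial:
  fixes f :: "real^'n \<Rightarrow> real"
  assumes f: "\<And>x. f differentiable (at x)" "\<And>x. partial_deriv i f differentiable (at x)" and h: "0 < h"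
  shows "\<exists>y. dist y x \<le> 2 * h \<and>
    f (x + h *\<^sub>R axis i 1 + h *\<^sub>R axis j 1) - f (x + h *\<^sub>R axis i 1)
      - f (x + h *\<^sub>R axis j 1) + f x = h * h * partial_deriv j (partial_deriv i f) y"
proof -
  let ?a = "axis i 1 :: real^'n" and ?b = "axis j 1 :: real^'n"
  let ?p = "partial_deriv i f"
  \<comment> \<open>The second difference is the increment in direction \<open>i\<close> of the
    first difference in direction \<open>j\<close>. One mean value step in direction
    \<open>i\<close> leaves a first difference of the partial derivative, to which a second one in
    direction \<open>j\<close> applies.\<close>
  have "\<exists>s>0. s < h \<and> (f ((x + h *\<^sub>R ?b) + h *\<^sub>R ?a) - f (x + h *\<^sub>R ?a))
      - (f ((x + h *\<^sub>R ?b) + 0 *\<^sub>R ?a) - f (x + 0 *\<^sub>R ?a))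
      = (h - 0) * (?p ((x + h *\<^sub>R ?b) + s *\<^sub>R ?a) - ?p (x + s *\<^sub>R ?a))"
    by (rule MVT2[OF h, where f = "\<lambda>s. f ((x + h *\<^sub>R ?b) + s *\<^sub>R ?a) - f (x + s *\<^sub>R ?a)"])
       (intro DERIV_diff has_field_derivative_along_axis f)
  then obtain s where s: "0 < s" "s < h" and 1: "(f ((x + h *\<^sub>R ?b) + h *\<^sub>R ?a) - f (x + h *\<^sub>R ?a))
      - (f (x + h *\<^sub>R ?b) - f x) = h * (?p ((x + h *\<^sub>R ?b) + s *\<^sub>R ?a) - ?p (x + s *\<^sub>R ?a))"
    by auto
  have "\<exists>t>0. t < h \<and> ?p ((x + s *\<^sub>R ?a) + h *\<^sub>R ?b) - ?p ((x + s *\<^sub>R ?a) + 0 *\<^sub>R ?b)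
      = (h - 0) * partial_deriv j ?p ((x + s *\<^sub>R ?a) + t *\<^sub>R ?b)"
    by (rule MVT2[OF h]) (intro has_field_derivative_along_axis f)
  then obtain t where t: "0 < t" "t < h" and 2: "?p ((x + s *\<^sub>R ?a) + h *\<^sub>R ?b) - ?p (x + s *\<^sub>R ?a)
      = h * partial_deriv j ?p ((x + s *\<^sub>R ?a) + t *\<^sub>R ?b)" by auto
  have "norm (s *\<^sub>R ?a + t *\<^sub>R ?b) \<le> norm (s *\<^sub>R ?a) + norm (t *\<^sub>R ?b)"
    by (rule norm_triangle_ineq)
  also have "\<dots> \<le> 2 * h" using s t by simp
  finally have "dist (x + s *\<^sub>R ?a + t *\<^sub>R ?b) x \<le> 2 * h" by (simp add: dist_norm)
  then show ?thesis using 1 2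
    by (intro exI[of _ "x + s *\<^sub>R ?a + t *\<^sub>R ?b"]) (auto simp: algebra_simps)
qed

text \<open>Both mixed derivatives, each at some point near \<open>x\<close>, equal the same second
  difference divided by h squared. If they differed at \<open>x\<close>, continuity would keep their
  values apart on a small ball.\<close>

lemma partial_deriv_commute:
  fixes f :: "real^'n \<Rightarrow> real"
  assumes f: "C_k (Suc (Suc 0)) f"
  shows "partial_deriv i (partial_deriv j f) x = partial_deriv j (partial_deriv i f) x"
proof (rule ccontr)
  let ?A = "partial_deriv i (partial_deriv j f)" and ?B = "partial_deriv j (partial_deriv i f)"
  assume "?A x \<noteq> ?B x"
  then have e: "dist (?A x) (?B x) / 2 > 0" by simp
  have cont: "isCont ?A x" "isCont ?B x"
    using f by (auto simp: continuous_on_eq_continuous_at)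
  obtain d1 where d1: "d1 > 0" "\<And>y. dist y x < d1 \<Longrightarrow> dist (?A y) (?A x) < dist (?A x) (?B x) / 2"
    using cont(1) e unfolding continuous_at_eps_delta by meson
  obtain d2 where d2: "d2 > 0" "\<And>y. dist y x < d2 \<Longrightarrow> dist (?B y) (?B x) < dist (?A x) (?B x) / 2"
    using cont(2) e unfolding continuous_at_eps_delta by meson
  \<comment> \<open>The intermediate points lie within 2h of \<open>x\<close>; dividing by 3 puts
    them strictly inside both continuity radii.\<close>
  define h where "h = min d1 d2 / 3"
  have h: "h > 0" "2 * h < d1" "2 * h < d2" using d1(1) d2(1) by (auto simp: h_def)
  have diff: "f differentiable (at y)" "partial_deriv k f differentiable (at y)" for y k
    using f by auto
  obtain y where y: "dist y x \<le> 2 * h" and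
    1: "f (x + h *\<^sub>R axis i 1 + h *\<^sub>R axis j 1) - f (x + h *\<^sub>R axis i 1)
      - f (x + h *\<^sub>R axis j 1) + f x = h * h * ?B y"
    using second_difference_eq_mixed_partial[OF diff h(1), of x i j] by blast
  obtain z where z: "dist z x \<le> 2 * h" and
    2: "f (x + h *\<^sub>R axis j 1 + h *\<^sub>R axis i 1) - f (x + h *\<^sub>R axis j 1)
      - f (x + h *\<^sub>R axis i 1) + f x = h * h * ?A z"
    using second_difference_eq_mixed_partial[OF diff h(1), of x j i] by blast
  have comm: "x + h *\<^sub>R axis i 1 + h *\<^sub>R axis j 1 = x + h *\<^sub>R axis j 1 + h *\<^sub>R axis i 1"
    by (simp only: add.assoc add.commute[of "h *\<^sub>R axis i 1"])
  have "h * h * ?A z = h * h * ?B y" using 1 2 unfolding comm by linarith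
  then have "?A z = ?B y" using h(1) by simp
  moreover have "dist (?A z) (?A x) < dist (?A x) (?B x) / 2" using d1(2) z h by force
  moreover have "dist (?B y) (?B x) < dist (?A x) (?B x) / 2" using d2(2) y h by force
  ultimately show False
    using dist_triangle_half_r[of "?A z" "?A x" "dist (?A x) (?B x)" "?B x"] by simp
qed

section \<open>The identities curl grad = 0 and div curl = 0\<close>

lemma classical_curl_nth:
  "classical_curl \<phi> x $ 1 = partial_deriv 2 \<phi> x $ 3 - partial_deriv 3 \<phi> x $ 2"
  "classical_curl \<phi> x $ 2 = partial_deriv 3 \<phi> x $ 1 - partial_deriv 1 \<phi> x $ 3"
  "classical_curl \<phi> x $ 3 = partial_deriv 1 \<phi> x $ 2 - partial_deriv 2 \<phi> x $ 1"
  by (simp_all add: classical_curl_def)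

lemma C_k_classical_grad: "C_k (Suc k) \<psi> \<Longrightarrow> C_k k (classical_grad \<psi>)"
  using C_k_vec[of k "\<lambda>j. partial_deriv j \<psi>"] by (simp add: classical_grad_def[abs_def])

lemma C_k_classical_curl:
  assumes "C_k (Suc k) \<phi>"
  shows "C_k k (classical_curl \<phi>)"
proof -
  have "C_k k (\<lambda>x. classical_curl \<phi> x $ i)" for i
    using exhaust_3[of i] assms 
    by (elim disjE; simp add: classical_curl_nth C_k_diff C_k_nth)
  from C_k_vec[of k "\<lambda>i x. classical_curl \<phi> x $ i", OF this] show ?thesis by simp
qed

lemma classical_curl_grad:
  assumes "C_k (Suc (Suc 0)) \<psi>"
  shows "classical_curl (classical_grad \<psi>) = (\<lambda>x. 0)"
proof
  fix x
  have "classical_grad \<psi> differentiable (at x)"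
    using C_k_classical_grad[OF assms] by simp
  then have "partial_deriv j (classical_grad \<psi>) x $ i = partial_deriv j (partial_deriv i \<psi>) x" for i j
    using partial_deriv_nth[of "classical_grad \<psi>" x j i] by (simp add: classical_grad_def)
  then show "classical_curl (classical_grad \<psi>) x = 0"
    unfolding vec_eq_iff forall_3 by (simp add: classical_curl_nth partial_deriv_commute[OF assms])
qed

lemma classical_div_curl:
  assumes "C_k (Suc (Suc 0)) \<phi>"
  shows "classical_div (classical_curl \<phi>) = (\<lambda>x. 0)"
proof
  fix x
  have nth: "partial_deriv j (\<lambda>x. \<phi> x $ i) = (\<lambda>x. partial_deriv j \<phi> x $ i)" for i j
    using assms by (simp add: fun_eq_iff partial_deriv_nth)
  have comm: "partial_deriv k (\<lambda>x. partial_deriv j \<phi> x $ i) x = partial_deriv j (\<lambda>x. partial_deriv k \<phi> x $ i) x" for i j k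
    using partial_deriv_commute[OF C_k_nth[OF assms, of i], of k j x] by (simp add: nth)
  have d: "(\<lambda>x. partial_deriv j \<phi> x $ i) differentiable (at x)" for i j
    using C_k_nth[of "Suc 0" "partial_deriv j \<phi>" i] assms by simp
  have "classical_curl \<phi> differentiable (at x)"
    using C_k_classical_curl[OF assms] by simp
  then have "classical_div (classical_curl \<phi>) x =
      (\<Sum>j\<in>UNIV. partial_deriv j (\<lambda>x. classical_curl \<phi> x $ j) x)"
    by (simp add: classical_div_def partial_deriv_nth)
  also have "\<dots> = 0"
    unfolding sum_3 classical_curl_nth using comm[of 1 2 3] comm[of 1 3 2] comm[of 2 3 1]
    by (simp add: partial_deriv_diff[OF d d])
  finally show "classical_div (classical_curl \<phi>) x = 0" .
qed

text \<open>The complement of the closed support is open, so \<phi> vanishes on a whole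
  neighbourhood of \<open>x\<close> and not merely at \<open>x\<close>.\<close>

lemma partial_deriv_outside_support:
  assumes "x \<notin> closure {x. \<phi> x \<noteq> 0}"
  shows "partial_deriv j \<phi> x = 0"
proof -
  have "((\<lambda>x. 0) has_derivative (\<lambda>h. 0)) (at x)" by simp
  then have "(\<phi> has_derivative (\<lambda>h. 0)) (at x)"
    by (rule has_derivative_transform_within_open[where s = "- closure {x. \<phi> x \<noteq> 0}"])
       (use assms closure_subset[of "{x. \<phi> x \<noteq> 0}"] in auto)
  from partial_deriv_eq[OF this] show ?thesis .
qed

lemma test_functions_C_k: "\<phi> \<in> test_functions U \<Longrightarrow> C_k k \<phi>"
  by (simp add: test_functions_def)

text \<open>A closed subset of a compact support is compact. Applied to gradients and curls, which
  cannot enlarge the support.\<close>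

lemma test_functions_supportI:
  assumes "\<phi> \<in> test_functions U" "\<And>k. C_k k \<psi>" "\<And>x. x \<notin> closure {x. \<phi> x \<noteq> 0} \<Longrightarrow> \<psi> x = 0"
  shows "\<psi> \<in> test_functions U"
proof -
  have "closure {x. \<psi> x \<noteq> 0} \<subseteq> closure {x. \<phi> x \<noteq> 0}"
    using assms(3) by (intro closure_minimal) auto
  moreover from this have "compact (closure {x. \<psi> x \<noteq> 0})"
    using assms(1) compact_Int_closed[of "closure {x. \<phi> x \<noteq> 0}" "closure {x. \<psi> x \<noteq> 0}"]
    by (simp add: test_functions_def Int_absorb1)
  ultimately show ?thesis using assms(1,2) by (auto simp: test_functions_def)
qed

lemma test_functions_grad:
  assumes "\<psi> \<in> test_functions U"
  shows "classical_grad \<psi> \<in> test_functions U"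
  by (rule test_functions_supportI[OF assms])
     (auto intro: C_k_classical_grad test_functions_C_k[OF assms]
       simp del: C_k.simps simp: classical_grad_def partial_deriv_outside_support vec_eq_iff)

lemma classical_curl_outside_support:
  assumes "x \<notin> closure {x. \<phi> x \<noteq> 0}"
  shows "classical_curl \<phi> x = 0"
  unfolding vec_eq_iff forall_3 classical_curl_nth
  by (simp add: partial_deriv_outside_support[OF assms])

lemma test_functions_curl:
  assumes "\<phi> \<in> test_functions U"
  shows "classical_curl \<phi> \<in> test_functions U"
  by (rule test_functions_supportI[OF assms])
     (auto intro: C_k_classical_curl test_functions_C_k[OF assms] classical_curl_outside_support simp del: C_k.simps)

lemma test_functions_outside:
  assumes "\<phi> \<in> test_functions U" "x \<notin> U"
  shows "\<phi> x = 0"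
  using assms closure_subset[of "{x. \<phi> x \<noteq> 0}"] by (auto simp: test_functions_def)

lemma test_functions_mono: "U \<subseteq> V \<Longrightarrow> test_functions U \<subseteq> test_functions V"
  by (auto simp: test_functions_def)

lemma square_integrable_test_function:
  fixes \<phi> :: "real^'n \<Rightarrow> 'b::euclidean_space"
  assumes "\<phi> \<in> test_functions U"
  shows "square_integrable \<phi>"
proof -
  let ?K = "closure {x. \<phi> x \<noteq> 0}"
  have cont: "continuous_on UNIV \<phi>" using test_functions_C_k[OF assms, of 0] by simp
  have "integrable lborel (\<lambda>x. indicator ?K x *\<^sub>R (norm (\<phi> x))\<^sup>2)"
    using assms
    by (intro borel_integrable_compact continuous_intros continuous_on_subset[OF cont])
       (auto simp: test_functions_def)
  also have "(\<lambda>x. indicator ?K x *\<^sub>R (norm (\<phi> x))\<^sup>2) = (\<lambda>x. (norm (\<phi> x))\<^sup>2)"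
    using closure_subset[of "{x. \<phi> x \<noteq> 0}"] by (auto simp: fun_eq_iff indicator_def)
  finally show ?thesis
    using borel_measurable_continuous_onI[OF cont] by (simp add: square_integrable_def)
qed

section \<open>Smooth approximation of box indicators\<close>

lemma poly_div_exp_tendsto_0: "((\<lambda>x. poly p x / exp x) \<longlongrightarrow> (0::real)) at_top"
proof -
  have "((\<lambda>x. \<Sum>i\<le>degree p. coeff p i * (x ^ i / exp x)) \<longlongrightarrow> (\<Sum>i\<le>degree p. coeff p i * 0)) at_top"
    by (intro tendsto_sum tendsto_mult tendsto_const tendsto_power_div_exp_0)
  then show ?thesis by (simp add: poly_altdef sum_divide_distrib)
qed

text \<open>Allowing a polynomial factor makes the class of flat functions closed under differentiation.\<close>

definition flat_exp :: "real poly \<Rightarrow> real \<Rightarrow> real" where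
  "flat_exp p t = (if t > 0 then poly p (1 / t) * exp (- (1 / t)) else 0)"

lemma flat_exp_tendsto_0: "(flat_exp p \<longlongrightarrow> 0) (at_right 0)"
proof -
  have "((\<lambda>t. poly p (inverse t) / exp (inverse t)) \<longlongrightarrow> 0) (at_right (0::real))"
    using filterlim_compose[OF poly_div_exp_tendsto_0 filterlim_inverse_at_top_right] .
  moreover have "eventually (\<lambda>t. poly p (inverse t) / exp (inverse t) = flat_exp p t) (at_right (0::real))"
    unfolding eventually_at_filter
    by (rule always_eventually) (auto simp: flat_exp_def exp_minus field_simps)
  ultimately show ?thesis by (rule Lim_transform_eventually)
qed

text \<open>For t > 0 the derivative is (p(1/t) - p'(1/t)) / t^2 times exp(-1/t), and
  \<open>[:0, 0, 1:]\<close> is the factor 1/t^2 written as a polynomial in 1/t. The only delicate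
  point is t = 0.\<close>

lemma flat_exp_has_field_derivative:
  "(flat_exp p has_field_derivative flat_exp ([:0, 0, 1:] * (p - pderiv p)) t) (at t)"
proof -
  consider "t > 0" | "t < 0" | "t = 0" by linarith
  then show ?thesis
  proof cases
    case 1
    have "((\<lambda>t. poly p (1 / t) * exp (- (1 / t))) has_field_derivative
        flat_exp ([:0, 0, 1:] * (p - pderiv p)) t) (at t)"
      using 1 by (auto intro!: derivative_eq_intros poly_DERIV[THEN DERIV_chain2]
          simp: flat_exp_def field_simps power2_eq_square)
    then show ?thesis
      by (rule DERIV_cong_ev[THEN iffD1, rotated -1])
         (use 1 in \<open>auto simp: flat_exp_def intro!: eventually_mono[OF eventually_nhds_in_open[of "{0<..}" t]]\<close>)
  next
    case 2
    have "((\<lambda>t. 0) has_field_derivative flat_exp ([:0, 0, 1:] * (p - pderiv p)) t) (at t)"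
      using 2 by (simp add: flat_exp_def)
    then show ?thesis
      by (rule DERIV_cong_ev[THEN iffD1, rotated -1])
         (use 2 in \<open>auto simp: flat_exp_def intro!: eventually_mono[OF eventually_nhds_in_open[of "{..<0}" t]]\<close>)
  next
    case 3
    have "((\<lambda>h. (flat_exp p h - flat_exp p 0) / (h - 0)) \<longlongrightarrow> 0) (at_left 0)"
      by (rule tendsto_eventually) (auto simp: eventually_at_filter flat_exp_def)
    moreover have "((\<lambda>h. (flat_exp p h - flat_exp p 0) / (h - 0)) \<longlongrightarrow> 0) (at_right 0)"
    \<comment> \<open>Dividing by h multiplies the polynomial by 1/h, so the right difference
      quotient at 0 is again a flat function and tends to 0.\<close>
    proof (rule Lim_transform_eventually[OF flat_exp_tendsto_0[of "[:0, 1:] * p"]])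
      show "eventually (\<lambda>h. flat_exp ([:0, 1:] * p) h = (flat_exp p h - flat_exp p 0) / (h - 0)) (at_right 0)"
        unfolding eventually_at_filter
        by (rule always_eventually) (auto simp: flat_exp_def)
    qed
    ultimately show ?thesis
      unfolding 3 has_field_derivative_iff by (simp add: filterlim_split_at flat_exp_def)
  qed
qed

text \<open>The induction must range over all polynomials \<open>p\<close>, since differentiating
  replaces \<open>p\<close> by another one. The affine argument covers both the rising and the
  falling profile of a bump.\<close>

lemma C_k_flat_exp_nth:
  fixes c d :: real and j :: "'n::finite"
  shows "C_k k (\<lambda>x::real^'n. flat_exp p (c * x $ j + d))"
proof (induction k arbitrary: p)
  case 0
  have "continuous_on UNIV (flat_exp p)"
    using flat_exp_has_field_derivative by (intro DERIV_continuous_on) auto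
  then have "continuous_on UNIV (\<lambda>x::real^'n. flat_exp p (c * x $ j + d))"
    by (rule continuous_on_compose2) (auto intro!: continuous_intros)
  then show ?case by simp
next
  case (Suc k)
  define q where "q = [:0, 0, 1:] * (p - pderiv p)"
  have *: "((\<lambda>x. flat_exp p (c * x $ j + d)) has_derivative
      (\<lambda>h. flat_exp q (c * x $ j + d) * (c * h $ j))) (at x)" for x :: "real^'n"
  proof -
    have "((\<lambda>x. c * x $ j + d) has_derivative (\<lambda>h. c * h $ j)) (at x)"
      by (auto intro!: derivative_eq_intros bounded_linear_imp_has_derivative bounded_linear_vec_nth)
    moreover have "(flat_exp p has_derivative (\<lambda>h. flat_exp q (c * x $ j + d) * h)) (at (c * x $ j + d))"
      using flat_exp_has_field_derivative unfolding q_def has_field_derivative_def by blast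
    ultimately show ?thesis by (rule has_derivative_compose)
  qed
  have "partial_deriv i (\<lambda>x::real^'n. flat_exp p (c * x $ j + d))
      = (\<lambda>x. flat_exp q (c * x $ j + d) * (c * axis i 1 $ j))" for i
    using partial_deriv_eq[OF *] by (simp add: fun_eq_iff)
  then show ?case
    using * Suc by (auto simp: differentiable_def intro!: C_k_mult)
qed

text \<open>Each coordinate contributes exp(-1/t) profiles vanishing at both faces of the box. The
  parameter \<open>c\<close> controls steepness: inside the box every factor tends to 1 as
  \<open>c\<close> grows, while the support stays in the closed box.\<close>

definition box_bump :: "real \<Rightarrow> real^'n \<Rightarrow> real^'n \<Rightarrow> real^'n \<Rightarrow> real" where
  "box_bump c a b x = (\<Prod>j\<in>UNIV. flat_exp 1 (c * (x $ j - a $ j)) * flat_exp 1 (c * (b $ j - x $ j)))"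

lemma flat_exp_1_bounds: "0 \<le> flat_exp 1 t" "flat_exp 1 t \<le> 1"
  by (auto simp: flat_exp_def)

lemma box_bump_bounds: "0 \<le> box_bump c a b x" "box_bump c a b x \<le> 1"
  unfolding box_bump_def
  by (auto intro!: prod_nonneg prod_le_1 mult_le_one flat_exp_1_bounds mult_nonneg_nonneg)

lemma box_bump_outside: "0 < c \<Longrightarrow> x \<notin> box a b \<Longrightarrow> box_bump c a b x = 0"
  unfolding box_bump_def mem_box_cart
  by (auto simp: flat_exp_def zero_less_mult_iff intro!: prod_zero)

lemma C_k_box_bump: "C_k k (box_bump c a b)"
proof -
  have "C_k k (\<lambda>x. \<Prod>j\<in>UNIV. flat_exp 1 (c * x $ j + - (c * a $ j)) * flat_exp 1 (- c * x $ j + c * b $ j))"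
    by (intro C_k_prod C_k_mult C_k_flat_exp_nth)
  then show ?thesis by (simp add: box_bump_def[abs_def] algebra_simps)
qed

lemma box_bump_test_function:
  assumes "0 < c" "cbox a b \<subseteq> U"
  shows "(\<lambda>x. box_bump c a b x *\<^sub>R e) \<in> test_functions U"
proof -
  have sub: "closure {x. box_bump c a b x *\<^sub>R e \<noteq> 0} \<subseteq> cbox a b"
    using box_bump_outside[OF assms(1)] box_subset_cbox
    by (intro closure_minimal) (auto, blast)
  then have "compact (closure {x. box_bump c a b x *\<^sub>R e \<noteq> 0})"
    using compact_Int_closed[OF compact_cbox[of a b] closed_closure] by (metis Int_absorb1)
  with sub assms(2) show ?thesis
    by (auto simp: test_functions_def C_k_scaleR_const C_k_box_bump)
qed

text \<open>Inside the box each factor is exp(-1/((n+1)t)) for a fixed t > 0; outside, every term is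
  already zero. The index \<open>Suc n\<close> keeps the parameter positive, as
  \<open>box_bump_outside\<close> demands.\<close>

lemma box_bump_tendsto_indicator:
  "(\<lambda>n. box_bump (real (Suc n)) a b x) \<longlonglongrightarrow> indicator (box a b) x"
proof (cases "x \<in> box a b")
  case True
  have "(\<lambda>n. flat_exp 1 (real (Suc n) * t)) \<longlonglongrightarrow> 1" if "t > 0" for t
  proof -
    have "(\<lambda>n. exp (- (inverse (real (Suc n)) * inverse t))) \<longlonglongrightarrow> exp (- (0 * inverse t))"
      by (intro tendsto_exp tendsto_minus tendsto_mult tendsto_const LIMSEQ_inverse_real_of_nat)
    moreover have "exp (- (inverse (real (Suc n)) * inverse t)) = flat_exp 1 (real (Suc n) * t)" for n
      using that by (simp add: flat_exp_def zero_less_mult_iff field_simps add_pos_nonneg)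
    ultimately show ?thesis by simp
  qed
  then have "(\<lambda>n. box_bump (real (Suc n)) a b x) \<longlonglongrightarrow> (\<Prod>j\<in>(UNIV::'a set). 1 * 1)"
    unfolding box_bump_def using True
    by (intro tendsto_prod tendsto_mult) (auto simp: mem_box_cart)
  with True show ?thesis by simp
next
  case False
  then have "box_bump (real (Suc n)) a b x = 0" for n by (intro box_bump_outside) auto
  with False show ?thesis by simp
qed

section \<open>Density of test functions\<close>

text \<open>A pi-lambda argument: boxes are stable under intersection and generate the Borel sets,
  and the Borel sets over which \<open>g\<close> integrates to zero are closed under complements and
  disjoint countable unions. The premise \<open>g0\<close> is what closes them under complements,
  the whole space not being a box.\<close>

lemma AE_eq_0_if_integrals_box_eq_0:
  fixes g :: "'a::euclidean_space \<Rightarrow> real"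
  assumes g: "integrable lborel g" and g0: "(\<integral>x. g x \<partial>lborel) = 0"
    and box: "\<And>a b. (\<integral>x. indicator (box a b) x * g x \<partial>lborel) = 0"
  shows "AE x in lborel. g x = 0"
proof -
  have int: "set_integrable lborel A g" if "A \<in> sets borel" for A
    unfolding set_integrable_def using integrable_mult_indicator[OF _ g] that by simp
  have zero: "(LINT x:A|lborel. g x) = 0" if "A \<in> sets borel" for A
  proof -
    let ?G = "range (\<lambda>(a, b). box a b :: 'a set)"
    have sig: "sets borel = sigma_sets UNIV ?G"
      by (subst borel_eq_box) (simp add: sets_measure_of)
    have "Int_stable ?G"
      by (auto simp: Int_stable_def box_Int_box)
    moreover have "?G \<subseteq> Pow UNIV" by simp
    moreover have "A \<in> sigma_sets UNIV ?G" using that sig by simp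
    ultimately show ?thesis
    proof (induction rule: sigma_sets_induct_disjoint)
      case (basic A)
      then show ?case using box by (auto simp: set_lebesgue_integral_def)
    next
      case empty
      then show ?case by (simp add: set_lebesgue_integral_def)
    next
      case (compl A)
      then have A: "A \<in> sets borel" using sig by simp
      then have cA: "UNIV - A \<in> sets borel" by auto
      have "(LINT x:A \<union> (UNIV - A)|lborel. g x) = (LINT x:A|lborel. g x) + (LINT x:UNIV - A|lborel. g x)"
        using int[OF A] int[OF cA] by (intro set_integral_Un) auto
      moreover have "(LINT x:A \<union> (UNIV - A)|lborel. g x) = 0"
        using g0 by (simp add: set_lebesgue_integral_def)
      ultimately show ?case using compl.IH by simp
    next
      case (union A)
      then have A: "A i \<in> sets borel" for i using sig by auto
      have "(LINT x:(\<Union>i. A i)|lborel. g x) = (\<Sum>i. (LINT x:A i|lborel. g x))"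
        using union(1) A int
        by (intro lebesgue_integral_countable_add) (auto simp: disjoint_family_on_def)
      then show ?case using union.IH by simp
    qed
  qed
  have [measurable]: "g \<in> borel_measurable borel" using g by auto
  \<comment> \<open>Integrating \<open>h\<close> over the set where it is positive gives zero, so
    that set is null; using both signs of \<open>g\<close> finishes the proof.\<close>
  have nn: "AE x in lborel. h x \<le> 0" if h: "h = g \<or> h = (\<lambda>x. - g x)" for h
  proof -
    have [measurable]: "h \<in> borel_measurable borel" using h by auto
    let ?P = "{x. h x > 0}"
    have P: "?P \<in> sets borel" by measurable
    have ih: "integrable lborel (\<lambda>x. indicator ?P x *\<^sub>R h x)"
      using g h P by (intro integrable_mult_indicator) auto
    have "(\<integral>x. indicator ?P x *\<^sub>R h x \<partial>lborel) = 0"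
      using h zero[OF P] by (auto simp: set_lebesgue_integral_def)
    moreover have "AE x in lborel. 0 \<le> indicator ?P x *\<^sub>R h x"
      by (intro AE_I2) (auto simp: indicator_def)
    ultimately have "AE x in lborel. indicator ?P x *\<^sub>R h x = 0"
      using integral_nonneg_eq_0_iff_AE[OF ih] by blast
    then show ?thesis by eventually_elim (auto simp: indicator_def split: if_splits)
  qed
  from nn[of g] nn[of "\<lambda>x. - g x"] show ?thesis
    by (auto elim: eventually_elim2)
qed

section \<open>Representatives of classes and their inner product\<close>

lemma square_integrable_rep_l2: "square_integrable (rep_l2 u)"
  using Quotient3_rep_reflp[OF Quotient3_l2, of u] by (simp add: l2rel_def)

lemma abs_l2_eq_iff:
  assumes "square_integrable f" "square_integrable g"
  shows "abs_l2 f = abs_l2 g \<longleftrightarrow> (AE x in lborel. f x = g x)"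
  using Quotient3_rel[OF Quotient3_l2, of f g] assms by (auto simp: l2rel_def)

lemma abs_rep_l2 [simp]: "abs_l2 (rep_l2 u) = u"
  by (rule Quotient3_abs_rep[OF Quotient3_l2])

lemma rep_abs_l2:
  assumes "square_integrable f"
  shows "AE x in lborel. rep_l2 (abs_l2 f) x = f x"
  using abs_l2_eq_iff[OF square_integrable_rep_l2 assms, of "abs_l2 f"] by simp

lemma inner_abs_l2:
  assumes "square_integrable f" "square_integrable g"
  shows "abs_l2 f \<bullet> abs_l2 g = (\<integral>x. f x \<bullet> g x \<partial>lborel)"
  using assms by (simp add: inner_l2.abs_eq l2rel_def)

lemma inner_abs_l2_right:
  "square_integrable g \<Longrightarrow> u \<bullet> abs_l2 g = (\<integral>x. rep_l2 u x \<bullet> g x \<partial>lborel)"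
  using inner_abs_l2[OF square_integrable_rep_l2, of g u] by simp

lemma square_integrable_indicator_box: "square_integrable (indicator (box a b) :: _ \<Rightarrow> real)"
proof -
  have "(\<lambda>x. (norm (indicator (box a b) x :: real))\<^sup>2) = indicator (box a b)"
    by (auto simp: fun_eq_iff indicator_def)
  then show ?thesis
    by (auto simp: square_integrable_def intro!: integrable_real_indicator emeasure_bounded_finite)
qed

text \<open>Bumps times a fixed vector \<open>e\<close> are admissible test fields because the
  closed box, which contains their support, lies in \<open>U\<close>. They are dominated by the
  indicator of the open box, so dominated convergence carries orthogonality over to that
  indicator.\<close>

lemma integral_box_eq_0_if_orthogonal_to_test_functions:
  fixes w :: "(real^'n, 'b::euclidean_space) l2"
  assumes orth: "\<And>\<phi>. \<phi> \<in> test_functions U \<Longrightarrow> w \<bullet> abs_l2 \<phi> = 0" and sub: "cbox a b \<subseteq> U"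
  shows "(\<integral>x. indicator (box a b) x * (rep_l2 w x \<bullet> e) \<partial>lborel) = 0"
proof -
  let ?f = "\<lambda>x. rep_l2 w x \<bullet> e"
  have [measurable]: "rep_l2 w \<in> borel_measurable borel"
    using square_integrable_rep_l2[of w] by (simp add: square_integrable_def)
  have bm [measurable]: "box_bump c a b \<in> borel_measurable borel" for c
    using C_k_box_bump[of 0 c a b] by (intro borel_measurable_continuous_onI) simp
  have "square_integrable (\<lambda>x. indicator (box a b) x *\<^sub>R e)"
    using square_integrable_indicator_box[of a b] by (auto simp: square_integrable_def power_mult_distrib)
  from square_integrable_inner[OF square_integrable_rep_l2[of w] this]
  have int: "integrable lborel (\<lambda>x. indicator (box a b) x * ?f x)" by simp
  have "(\<lambda>n. \<integral>x. box_bump (real (Suc n)) a b x * ?f x \<partial>lborel)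
      \<longlonglongrightarrow> (\<integral>x. indicator (box a b) x * ?f x \<partial>lborel)"
  proof (rule integral_dominated_convergence)
    show "integrable lborel (\<lambda>x. norm (indicator (box a b) x * ?f x))"
      using int by (rule integrable_norm)
    show "AE x in lborel. (\<lambda>n. box_bump (real (Suc n)) a b x * ?f x) \<longlonglongrightarrow> indicator (box a b) x * ?f x"
      by (intro AE_I2 tendsto_mult tendsto_const box_bump_tendsto_indicator)
    show "AE x in lborel. norm (box_bump (real (Suc n)) a b x * ?f x) \<le> norm (indicator (box a b) x * ?f x)" for n
    proof (rule AE_I2)
      fix x
      have "\<bar>box_bump (real (Suc n)) a b x\<bar> \<le> indicator (box a b) x"
        using box_bump_bounds[of "real (Suc n)" a b x] box_bump_outside[of "real (Suc n)" x a b]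
        by (cases "x \<in> box a b") auto
      then show "norm (box_bump (real (Suc n)) a b x * ?f x) \<le> norm (indicator (box a b) x * ?f x)"
        by (simp add: abs_mult mult_right_mono)
    qed
  qed measurable
  moreover have "(\<integral>x. box_bump (real (Suc n)) a b x * ?f x \<partial>lborel) = 0" for n
  proof -
    have t: "(\<lambda>x. box_bump (real (Suc n)) a b x *\<^sub>R e) \<in> test_functions U"
      using sub by (intro box_bump_test_function) auto
    show ?thesis
      using orth[OF t] inner_abs_l2_right[OF square_integrable_test_function[OF t], of w] by simp
  qed
  ultimately show ?thesis by (simp add: LIMSEQ_const_iff)
qed

text \<open>The argument is local: on every box whose closure lies in \<open>U\<close> each
  component vanishes almost everywhere. Outside \<open>U\<close> the class vanishes by membership in
  \<open>L2 U\<close>.\<close>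

theorem orthogonal_to_test_functions_imp_0:
  fixes w :: "(real^'n, 'b::euclidean_space) l2"
  assumes U: "open U" and w: "w \<in> L2 U"
    and orth: "\<And>\<phi>. \<phi> \<in> test_functions U \<Longrightarrow> w \<bullet> abs_l2 \<phi> = 0"
  shows "w = 0"
proof -
  have [measurable]: "rep_l2 w \<in> borel_measurable borel"
    using square_integrable_rep_l2[of w] by (simp add: square_integrable_def)
  have box0: "AE x in lborel. x \<in> box a b \<longrightarrow> rep_l2 w x \<bullet> e = 0" if ab: "cbox a b \<subseteq> U" for a b e
  proof -
    let ?g = "\<lambda>x. indicator (box a b) x * (rep_l2 w x \<bullet> e)"
    have "square_integrable (\<lambda>x. indicator (box a b) x *\<^sub>R e)"
      using square_integrable_indicator_box[of a b] by (auto simp: square_integrable_def power_mult_distrib)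
    from square_integrable_inner[OF square_integrable_rep_l2[of w] this]
    have int: "integrable lborel ?g" by simp
    have "(\<integral>x. indicator (box c d) x * ?g x \<partial>lborel) = 0" for c d
    proof -
      \<comment> \<open>Corners of the intersection of the two boxes, which is again a box with
        closure in \<open>U\<close>, so the preceding lemma covers it even when
        \<open>box c d\<close> leaves \<open>U\<close>.\<close>
      let ?c = "\<Sum>i\<in>Basis. max (c \<bullet> i) (a \<bullet> i) *\<^sub>R i" and ?d = "\<Sum>i\<in>Basis. min (d \<bullet> i) (b \<bullet> i) *\<^sub>R i"
      have "cbox ?c ?d \<subseteq> U" using ab Int_interval[of c d a b] by blast
      from integral_box_eq_0_if_orthogonal_to_test_functions[OF orth this, of e]
      have "(\<integral>x. indicator (box c d \<inter> box a b) x * (rep_l2 w x \<bullet> e) \<partial>lborel) = 0"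
        by (simp only: box_Int_box)
      then show ?thesis by (simp add: indicator_inter_arith mult.assoc)
    qed
    moreover have "(\<integral>x. ?g x \<partial>lborel) = 0"
      by (rule integral_box_eq_0_if_orthogonal_to_test_functions[OF orth ab])
    ultimately have "AE x in lborel. ?g x = 0"
      using AE_eq_0_if_integrals_box_eq_0[OF int] by blast
    then show ?thesis by eventually_elim (auto simp: indicator_def)
  qed
  have box: "AE x in lborel. x \<in> box a b \<longrightarrow> rep_l2 w x = 0" if "cbox a b \<subseteq> U" for a b
  proof -
    have "AE x in lborel. \<forall>e\<in>Basis. x \<in> box a b \<longrightarrow> rep_l2 w x \<bullet> e = 0"
      using box0[OF that] by (intro AE_finite_allI) auto
    then show ?thesis by eventually_elim (auto intro: euclidean_eqI)
  qed
  define F where "F = {box a b | a b. cbox a b \<subseteq> U}"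
  have "\<Union>F = U"
  proof
    show "\<Union>F \<subseteq> U" using box_subset_cbox by (fastforce simp: F_def)
    show "U \<subseteq> \<Union>F"
    proof
      fix x assume "x \<in> U"
      then obtain a b where "cbox a b \<subseteq> U" "x \<in> box a b"
        using open_contains_cbox[OF U] by metis
      then show "x \<in> \<Union>F" by (auto simp: F_def)
    qed
  qed
  \<comment> \<open>Almost-everywhere statements combine only countably often, whereas the boxes
    covering \<open>U\<close> are uncountably many.\<close>
  moreover obtain F' where F': "F' \<subseteq> F" "countable F'" "\<Union>F' = \<Union>F"
    by (rule Lindelof[of F]) (auto simp: F_def)
  moreover have "AE x in lborel. \<forall>S\<in>F'. x \<in> S \<longrightarrow> rep_l2 w x = 0"
    using F'(1) box by (subst AE_ball_countable[OF F'(2)]) (auto simp: F_def)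
  ultimately have "AE x in lborel. x \<in> U \<longrightarrow> rep_l2 w x = 0"
    by (auto elim!: eventually_mono)
  moreover have "AE x in lborel. x \<notin> U \<longrightarrow> rep_l2 w x = 0" using w by (simp add: L2_def)
  ultimately have "AE x in lborel. rep_l2 w x = 0" by eventually_elim blast
  then have "abs_l2 (rep_l2 w) = abs_l2 (\<lambda>x. 0)"
    by (subst abs_l2_eq_iff) (auto simp: square_integrable_rep_l2)
  then show ?thesis by (simp add: zero_l2.abs_eq)
qed

section \<open>Restriction and broken spaces\<close>

lemma l2_eqI: "(AE x in lborel. rep_l2 u x = rep_l2 v x) \<Longrightarrow> u = v"
  using abs_l2_eq_iff[OF square_integrable_rep_l2[of u] square_integrable_rep_l2[of v]] by simp

lemma abs_l2_0: "abs_l2 (\<lambda>x. 0) = 0"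
  by (simp add: zero_l2.abs_eq)

text \<open>Representatives are chosen arbitrarily within a class, so \<open>rep_l2\<close> respects
  the vector space operations only almost everywhere.\<close>

lemma rep_l2_0: "AE x in lborel. rep_l2 0 x = 0"
  unfolding zero_l2.abs_eq by (rule rep_abs_l2) simp

lemma rep_l2_add: "AE x in lborel. rep_l2 (u + v) x = rep_l2 u x + rep_l2 v x"
proof -
  have "abs_l2 (\<lambda>x. rep_l2 u x + rep_l2 v x) = u + v"
    using plus_l2.abs_eq[of "rep_l2 u" "rep_l2 v"] by (simp add: l2rel_def square_integrable_rep_l2)
  then show ?thesis
    using rep_abs_l2[OF square_integrable_add[OF square_integrable_rep_l2 square_integrable_rep_l2], of u v]
    by simp
qed

lemma rep_l2_scaleR: "AE x in lborel. rep_l2 (c *\<^sub>R u) x = c *\<^sub>R rep_l2 u x"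
proof -
  have "abs_l2 (\<lambda>x. c *\<^sub>R rep_l2 u x) = c *\<^sub>R u"
    using scaleR_l2.abs_eq[of "rep_l2 u" c] by (simp add: l2rel_def square_integrable_rep_l2)
  then show ?thesis
    using rep_abs_l2[OF square_integrable_scaleR[OF square_integrable_rep_l2], of c u] by simp
qed

lemma rep_l2_sum: "finite I \<Longrightarrow> AE x in lborel. rep_l2 (\<Sum>i\<in>I. u i) x = (\<Sum>i\<in>I. rep_l2 (u i) x)"
proof (induction I rule: finite_induct)
  case empty
  then show ?case using rep_l2_0 by simp
next
  case (insert i I)
  have "AE x in lborel. rep_l2 (u i + (\<Sum>i\<in>I. u i)) x = rep_l2 (u i) x + rep_l2 (\<Sum>i\<in>I. u i) x"
    by (rule rep_l2_add)
  with insert.IH show ?case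
    using insert.hyps by (auto elim: eventually_elim2)
qed

lemma subspace_L2: "subspace (L2 U :: ('a::euclidean_space, 'b::euclidean_space) l2 set)"
proof (rule subspaceI)
  show "(0 :: ('a, 'b) l2) \<in> L2 U"
    using rep_l2_0[where ?'a = 'a and ?'b = 'b] by (auto simp: L2_def elim: eventually_mono)
next
  fix u v :: "('a, 'b) l2"
  assume "u \<in> L2 U" "v \<in> L2 U"
  then have "AE x in lborel. x \<notin> U \<longrightarrow> rep_l2 u x = 0" "AE x in lborel. x \<notin> U \<longrightarrow> rep_l2 v x = 0"
    by (simp_all add: L2_def)
  then have "AE x in lborel. x \<notin> U \<longrightarrow> rep_l2 (u + v) x = 0"
    using rep_l2_add[of u v] by eventually_elim simp
  then show "u + v \<in> L2 U" by (simp add: L2_def)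
next
  fix c :: real and u :: "('a, 'b) l2"
  assume "u \<in> L2 U"
  then have "AE x in lborel. x \<notin> U \<longrightarrow> rep_l2 u x = 0" by (simp add: L2_def)
  then have "AE x in lborel. x \<notin> U \<longrightarrow> rep_l2 (c *\<^sub>R u) x = 0"
    using rep_l2_scaleR[of c u] by eventually_elim simp
  then show "c *\<^sub>R u \<in> L2 U" by (simp add: L2_def)
qed

section \<open>Restriction to subdomains and decomposition over the partition\<close>

lemma square_integrable_indicator_scaleR:
  assumes "U \<in> sets borel" "square_integrable f"
  shows "square_integrable (\<lambda>x. indicator U x *\<^sub>R f x)"
proof -
  have "integrable lborel (\<lambda>x. indicator U x *\<^sub>R (norm (f x))\<^sup>2)"
    using assms by (intro integrable_mult_indicator) (auto simp: square_integrable_def)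
  also have "(\<lambda>x. indicator U x *\<^sub>R (norm (f x))\<^sup>2) = (\<lambda>x. (norm (indicator U x *\<^sub>R f x))\<^sup>2)"
    by (auto simp: fun_eq_iff indicator_def)
  finally show ?thesis using assms by (auto simp: square_integrable_def)
qed

lemma rep_restr:
  "U \<in> sets borel \<Longrightarrow> AE x in lborel. rep_l2 (restr U u) x = indicator U x *\<^sub>R rep_l2 u x"
  unfolding restr_def
  by (intro rep_abs_l2 square_integrable_indicator_scaleR square_integrable_rep_l2)

lemma restr_in_L2: "U \<in> sets borel \<Longrightarrow> restr U u \<in> L2 U"
  using rep_restr[of U u] by (auto simp: L2_def elim!: eventually_mono)

lemma restr_add:
  assumes "U \<in> sets borel"
  shows "restr U (u + v) = restr U u + restr U v"
proof (rule l2_eqI)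
  show "AE x in lborel. rep_l2 (restr U (u + v)) x = rep_l2 (restr U u + restr U v) x"
    using rep_restr[OF assms, of u] rep_restr[OF assms, of v] rep_restr[OF assms, of "u + v"]
      rep_l2_add[of u v] rep_l2_add[of "restr U u" "restr U v"]
    by eventually_elim (simp add: scaleR_add_right)
qed

lemma restr_scaleR:
  assumes "U \<in> sets borel"
  shows "restr U (c *\<^sub>R u) = c *\<^sub>R restr U u"
proof (rule l2_eqI)
  show "AE x in lborel. rep_l2 (restr U (c *\<^sub>R u)) x = rep_l2 (c *\<^sub>R restr U u) x"
    using rep_restr[OF assms, of u] rep_restr[OF assms, of "c *\<^sub>R u"]
      rep_l2_scaleR[of c u] rep_l2_scaleR[of c "restr U u"]
    by eventually_elim simp
qed

lemma restr_0: "U \<in> sets borel \<Longrightarrow> restr U 0 = 0"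
  using restr_scaleR[of U 0 0] by simp

lemma inner_restr:
  assumes U: "U \<in> sets borel" and g: "square_integrable g" "\<And>x. x \<notin> U \<Longrightarrow> g x = 0"
  shows "restr U u \<bullet> abs_l2 g = u \<bullet> abs_l2 g"
proof -
  have [measurable]: "rep_l2 v \<in> borel_measurable borel" "g \<in> borel_measurable borel" for v :: "('a, 'b) l2"
    using square_integrable_rep_l2[of v] g by (simp_all add: square_integrable_def)
  have "AE x in lborel. rep_l2 (restr U u) x \<bullet> g x = rep_l2 u x \<bullet> g x"
    using rep_restr[OF U, of u]
  proof eventually_elim
    case (elim x)
    then show ?case using g(2)[of x] by (cases "x \<in> U") auto
  qed
  then show ?thesis
    unfolding inner_abs_l2_right[OF g(1)] by (intro integral_cong_AE) auto
qed

text \<open>Disjointness makes the indicators of the subdomains add up to that of their union, and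
  the union misses only a null set of \<Omega>.\<close>

lemma sum_restr_partition:
  assumes part: "domain_partition \<Omega> K \<Omega>s" and v: "v \<in> L2 \<Omega>"
  shows "v = (\<Sum>k\<in>{1..K}. restr (\<Omega>s k) v)"
proof (rule l2_eqI)
  have op: "open \<Omega>" "\<And>k. k \<in> {1..K} \<Longrightarrow> open (\<Omega>s k)"
    using part by (auto simp: domain_partition_def domain_def)
  let ?N = "\<Omega> - (\<Union>k\<in>{1..K}. \<Omega>s k)"
  have "?N \<in> null_sets lebesgue"
    using part by (simp add: domain_partition_def negligible_iff_null_sets)
  \<comment> \<open>Negligibility speaks of the completed measure; being Borel transfers the null
    set to \<open>lborel\<close>.\<close>
  moreover have "?N \<in> sets borel" using op by (intro sets.Diff borel_open open_UN) auto
  ultimately have "?N \<in> null_sets lborel" by (simp add: null_sets_def)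
  then have "AE x in lborel. x \<notin> ?N" by (rule AE_not_in)
  moreover have "AE x in lborel. \<forall>k\<in>{1..K}. rep_l2 (restr (\<Omega>s k) v) x = indicator (\<Omega>s k) x *\<^sub>R rep_l2 v x"
    using op by (intro AE_finite_allI rep_restr) auto
  moreover have "AE x in lborel. x \<notin> \<Omega> \<longrightarrow> rep_l2 v x = 0" using v by (simp add: L2_def)
  moreover have "AE x in lborel. rep_l2 (\<Sum>k\<in>{1..K}. restr (\<Omega>s k) v) x
      = (\<Sum>k\<in>{1..K}. rep_l2 (restr (\<Omega>s k) v) x)"
    by (rule rep_l2_sum) simp
  ultimately show "AE x in lborel. rep_l2 v x = rep_l2 (\<Sum>k\<in>{1..K}. restr (\<Omega>s k) v) x"
  proof eventually_elim
    case (elim x)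
    have "(\<Sum>k\<in>{1..K}. rep_l2 (restr (\<Omega>s k) v) x) = (\<Sum>k\<in>{1..K}. indicator (\<Omega>s k) x *\<^sub>R rep_l2 v x)"
      using elim by (intro sum.cong) auto
    also have "\<dots> = (\<Sum>k\<in>{1..K}. indicator (\<Omega>s k) x) *\<^sub>R rep_l2 v x"
      by (simp only: scaleR_left.sum)
    also have "(\<Sum>k\<in>{1..K}. indicator (\<Omega>s k) x :: real) = indicator (\<Union>k\<in>{1..K}. \<Omega>s k) x"
      using part by (subst indicator_UN_disjoint) (auto simp: domain_partition_def)
    also have "indicator (\<Union>k\<in>{1..K}. \<Omega>s k) x *\<^sub>R rep_l2 v x = rep_l2 v x"
      using elim by (auto simp: indicator_def)
    finally show ?case using elim by simp
  qed
qed

text \<open>A broken field is the sum of its restrictions, so the union of the local spanning sets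
  spans a space containing all of them; containment is enough for
  \<open>finite_dim_subspaceI\<close>.\<close>

lemma finite_dim_broken_space:
  assumes part: "domain_partition \<Omega> K \<Omega>s"
    and Vs: "\<And>k. k \<in> {1..K} \<Longrightarrow> finite_dim_subspace (Vs k)"
  shows "finite_dim_subspace (broken_space \<Omega> K \<Omega>s Vs)"
proof -
  have meas: "\<Omega>s k \<in> sets borel" if "k \<in> {1..K}" for k
    using part that by (auto simp: domain_partition_def domain_def)
  have sub: "subspace (Vs k)" if "k \<in> {1..K}" for k
    by (rule finite_dim_subspace_subspace[OF Vs[OF that]])
  obtain B where B: "\<And>k. k \<in> {1..K} \<Longrightarrow> finite (B k) \<and> Vs k = span (B k)"
    using Vs unfolding finite_dim_subspace_def by metis
  show ?thesis
  proof (rule finite_dim_subspaceI)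
    show "subspace (broken_space \<Omega> K \<Omega>s Vs)"
      unfolding broken_space_def using subspace_L2[of \<Omega>] sub
      by (auto simp: subspace_def restr_add[OF meas] restr_scaleR[OF meas] restr_0[OF meas])
    show "finite (\<Union>k\<in>{1..K}. B k)" using B by auto
    show "broken_space \<Omega> K \<Omega>s Vs \<subseteq> span (\<Union>k\<in>{1..K}. B k)"
    proof
      fix v assume v: "v \<in> broken_space \<Omega> K \<Omega>s Vs"
      have "restr (\<Omega>s k) v \<in> span (\<Union>k\<in>{1..K}. B k)" if k: "k \<in> {1..K}" for k
      proof -
        have "restr (\<Omega>s k) v \<in> span (B k)" using v k B[OF k] by (auto simp: broken_space_def)
        moreover have "span (B k) \<subseteq> span (\<Union>k\<in>{1..K}. B k)" using k by (intro span_mono) auto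
        ultimately show ?thesis by blast
      qed
      then have "(\<Sum>k\<in>{1..K}. restr (\<Omega>s k) v) \<in> span (\<Union>k\<in>{1..K}. B k)" by (rule span_sum)
      then show "v \<in> span (\<Union>k\<in>{1..K}. B k)"
        using sum_restr_partition[OF part, of v] v by (simp add: broken_space_def)
    qed
  qed
qed

section \<open>The weak curl\<close>

lemma has_weak_curl_unique:
  assumes U: "open U" and w: "has_weak_curl U u w" "has_weak_curl U u w'"
  shows "w = w'"
proof -
  have "w - w' = 0"
  proof (rule orthogonal_to_test_functions_imp_0[OF U])
    show "w - w' \<in> L2 U"
      using w subspace_diff[OF subspace_L2] by (auto simp: has_weak_curl_def)
  qed (use w in \<open>auto simp: has_weak_curl_def inner_diff_left\<close>)
  then show ?thesis by simp
qed

lemma curl_eqI: "open U \<Longrightarrow> has_weak_curl U u w \<Longrightarrow> curl U u = w"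
  unfolding curl_def using has_weak_curl_unique by blast

lemma has_weak_curl_curl: "open U \<Longrightarrow> u \<in> Hcurl U \<Longrightarrow> has_weak_curl U u (curl U u)"
  using curl_eqI by (auto simp: Hcurl_def)

text \<open>Linearity is a consequence of uniqueness: the sum of two weak curls satisfies the
  defining identity for the sum of the fields, and likewise for multiples.\<close>

lemma linear_map_on_curl:
  assumes U: "open U" and V: "V \<subseteq> Hcurl U"
  shows "linear_map_on V (L2 U) (curl U)"
proof -
  have w: "has_weak_curl U v (curl U v)" if "v \<in> V" for v
    using has_weak_curl_curl[OF U] V that by blast
  have "curl U (u + v) = curl U u + curl U v" if "u \<in> V" "v \<in> V" for u v
    using w[OF that(1)] w[OF that(2)] subspace_add[OF subspace_L2[of U], of "curl U u" "curl U v"]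
    by (intro curl_eqI[OF U]) (auto simp: has_weak_curl_def inner_add_left)
  moreover have "curl U (c *\<^sub>R v) = c *\<^sub>R curl U v" if "v \<in> V" for c v
    using w[OF that] subspace_scale[OF subspace_L2[of U], of "curl U v"]
    by (intro curl_eqI[OF U]) (auto simp: has_weak_curl_def)
  moreover have "curl U v \<in> L2 U" if "v \<in> V" for v
    using w[OF that] by (simp add: has_weak_curl_def)
  ultimately show ?thesis by (auto simp: linear_map_on_def)
qed

text \<open>Test fields on \<open>W\<close> are test fields on \<open>U\<close>, and neither they
  nor their curls see values outside \<open>W\<close>.\<close>

lemma has_weak_curl_restr:
  assumes W: "open W" "W \<subseteq> U" and u: "has_weak_curl U u w"
  shows "has_weak_curl W (restr W u) (restr W w)"
  unfolding has_weak_curl_def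
proof (intro conjI ballI)
  show "restr W w \<in> L2 W" using W(1) by (intro restr_in_L2) simp
  fix \<phi> :: "real^3 \<Rightarrow> real^3" assume \<phi>: "\<phi> \<in> test_functions W"
  have r: "restr W v \<bullet> abs_l2 \<psi> = v \<bullet> abs_l2 \<psi>"
    if "\<psi> \<in> test_functions W" for v and \<psi> :: "real^3 \<Rightarrow> real^3"
    using that W(1)
    by (intro inner_restr square_integrable_test_function[OF that] test_functions_outside[OF that]) auto
  have "\<phi> \<in> test_functions U" using \<phi> test_functions_mono[OF W(2)] by blast
  then show "restr W u \<bullet> abs_l2 (classical_curl \<phi>) = restr W w \<bullet> abs_l2 \<phi>"
    using u by (simp add: r \<phi> test_functions_curl has_weak_curl_def)
qed

text \<open>By uniqueness on each subdomain, the restriction of the global curl is the local curl of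
  the restriction, which lies in the local space by hypothesis.\<close>

lemma curl_in_broken_space:
  assumes part: "domain_partition \<Omega> K \<Omega>s"
    and curl: "\<And>k. k \<in> {1..K} \<Longrightarrow> curl (\<Omega>s k) ` V1s k \<subseteq> V2s k"
    and v: "v \<in> broken_space \<Omega> K \<Omega>s V1s" "v \<in> Hcurl \<Omega>"
  shows "curl \<Omega> v \<in> broken_space \<Omega> K \<Omega>s V2s"
proof -
  have op: "open \<Omega>" using part by (simp add: domain_partition_def domain_def)
  have w: "has_weak_curl \<Omega> v (curl \<Omega> v)" by (rule has_weak_curl_curl[OF op v(2)])
  have "restr (\<Omega>s k) (curl \<Omega> v) \<in> V2s k" if k: "k \<in> {1..K}" for k
  proof -
    have "open (\<Omega>s k)" "\<Omega>s k \<subseteq> \<Omega>"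
      using part k by (auto simp: domain_partition_def domain_def)
    from curl_eqI[OF this(1) has_weak_curl_restr[OF this w]]
    have "restr (\<Omega>s k) (curl \<Omega> v) = curl (\<Omega>s k) (restr (\<Omega>s k) v)" by simp
    then show ?thesis using curl[OF k] v(1) k by (auto simp: broken_space_def)
  qed
  then show ?thesis using w by (auto simp: broken_space_def has_weak_curl_def)
qed

text \<open>Weakly, curl grad = 0 gives the curl divergence zero. The approximants are the curls of
  the test fields approximating \<open>u\<close>: by div curl = 0 their divergences vanish, so
  convergence in the graph norm of the divergence is just the convergence of the curls already
  known.\<close>

lemma curl_H0curl_in_H0div:
  assumes U: "open U" and u: "u \<in> H0curl U"
  shows "curl U u \<in> H0div U"
proof -
  have uc: "has_weak_curl U u (curl U u)"
    using has_weak_curl_curl[OF U] u by (simp add: H0curl_def)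
  have div0: "has_weak_div U (curl U u) 0"
    unfolding has_weak_div_def
  proof (intro conjI ballI)
    show "0 \<in> L2 U" by (rule subspace_0[OF subspace_L2])
    fix \<psi> :: "real^3 \<Rightarrow> real" assume \<psi>: "\<psi> \<in> test_functions U"
    have "curl U u \<bullet> abs_l2 (classical_grad \<psi>) = u \<bullet> abs_l2 (classical_curl (classical_grad \<psi>))"
      using uc test_functions_grad[OF \<psi>] by (simp add: has_weak_curl_def)
    also have "\<dots> = 0" by (simp add: classical_curl_grad test_functions_C_k[OF \<psi>] abs_l2_0 del: C_k.simps)
    finally show "curl U u \<bullet> abs_l2 (classical_grad \<psi>) = - (0 \<bullet> abs_l2 \<psi>)" by simp
  qed
  have "weak_div U (curl U u) = 0"
    unfolding weak_div_def
  proof (rule the_equality)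
    show "has_weak_div U (curl U u) 0" by (rule div0)
    fix g assume g: "has_weak_div U (curl U u) g"
    show "g = 0"
    proof (rule orthogonal_to_test_functions_imp_0[OF U])
      show "g \<in> L2 U" using g by (simp add: has_weak_div_def)
      show "g \<bullet> abs_l2 \<psi> = 0" if "\<psi> \<in> test_functions U" for \<psi>
        using g div0 that by (simp add: has_weak_div_def)
    qed
  qed
  moreover have "\<exists>\<phi>\<in>test_functions U. norm (curl U u - abs_l2 \<phi>) < e
      \<and> norm (0 - abs_l2 (classical_div \<phi>)) < e" if e: "e > 0" for e
  proof -
    obtain \<phi> where \<phi>: "\<phi> \<in> test_functions U" "norm (curl U u - abs_l2 (classical_curl \<phi>)) < e"
      using u e by (auto simp: H0curl_def)
    moreover have "classical_div (classical_curl \<phi>) = (\<lambda>x. 0)"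
      by (intro classical_div_curl test_functions_C_k[OF \<phi>(1)])
    ultimately show ?thesis
      using e test_functions_curl[OF \<phi>(1)]
      by (intro bexI[of _ "classical_curl \<phi>"]) (auto simp: abs_l2_0)
  qed
  moreover have "curl U u \<in> Hdiv U"
    using uc div0 by (auto simp: Hdiv_def has_weak_curl_def)
  ultimately show ?thesis by (simp add: H0div_def)
qed

section \<open>The discrete problems\<close>

lemma conforming_solution_exists_unique:
  assumes fin: "finite_dim_subspace V" and A: "linear_map_on V W (curl \<Omega>)"
    and eig: "\<not> eigenvalue_on V (\<lambda>v. curlt_c \<Omega> V W (curl \<Omega> v)) (\<omega>\<^sup>2)"
  shows "\<exists>!u. conforming_solution \<Omega> V \<omega> J u"
proof -
  have sub: "subspace V" by (rule finite_dim_subspace_subspace[OF fin])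
  let ?C = "curlt_c \<Omega> V W"
  define T where "T u = ?C (curl \<Omega> u) - \<omega>\<^sup>2 *\<^sub>R u" for u
  have CV: "?C (curl \<Omega> u) \<in> V" if "u \<in> V" for u
    unfolding curlt_c_def using adjoint_on(1)[OF fin A] linear_map_onD(1)[OF A that] by blast
  have TV: "T u \<in> V" if "u \<in> V" for u
    unfolding T_def using that by (intro subspace_diff[OF sub] subspace_scale[OF sub] CV)
  have T: "T u \<bullet> v = - \<omega>\<^sup>2 * (v \<bullet> u) + curl \<Omega> v \<bullet> curl \<Omega> u" if "u \<in> V" "v \<in> V" for u v
    using adjoint_on(2)[OF fin A linear_map_onD(1)[OF A that(1)] that(2)]
   
    by (simp add: T_def curlt_c_def inner_diff_left inner_commute[of v u] inner_commute[of "curl \<Omega> v"])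
  \<comment> \<open>The chosen adjoint carries no evident linearity; it is recovered by testing,
    since the weak form of \<open>T\<close> is bilinear.\<close>
  have lin: "linear_map_on V V T"
    unfolding linear_map_on_def
  proof (intro conjI ballI allI)
    show "T ` V \<subseteq> V" using TV by blast
    fix u assume u: "u \<in> V"
    show "T (u + v) = T u + T v" if v: "v \<in> V" for v
    proof (rule eq_on_subspaceI[OF sub])
      show "T (u + v) \<in> V" "T u + T v \<in> V"
        using u v TV subspace_add[OF sub] by auto
      fix x assume "x \<in> V"
      with u v show "T (u + v) \<bullet> x = (T u + T v) \<bullet> x"
        by (simp add: inner_add_left T subspace_add[OF sub] linear_map_onD(2)[OF A] inner_add_right algebra_simps)
    qed
    show "T (c *\<^sub>R u) = c *\<^sub>R T u" for c
    proof (rule eq_on_subspaceI[OF sub])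
      show "T (c *\<^sub>R u) \<in> V" "c *\<^sub>R T u \<in> V"
        using u TV subspace_scale[OF sub] by auto
      fix x assume "x \<in> V"
      with u show "T (c *\<^sub>R u) \<bullet> x = (c *\<^sub>R T u) \<bullet> x"
        by (simp add: T subspace_scale[OF sub] linear_map_onD(3)[OF A] algebra_simps)
    qed
  qed
  have inj: "u = 0" if "u \<in> V" "T u = 0" for u
    using that eig by (auto simp: eigenvalue_on_def T_def)
  \<comment> \<open>The representative \<open>z\<close> is the orthogonal projection of
    \<open>J\<close> onto \<open>V\<close>; it turns the variational problem into the equation
    \<open>T u = z\<close> inside \<open>V\<close>.\<close>
  have "linear_map_on V UNIV (\<lambda>v. J \<bullet> v)"
    by (auto simp: linear_map_on_def inner_add_right)
  from riesz_on[OF fin this] obtain z where z: "z \<in> V" "\<And>v. v \<in> V \<Longrightarrow> z \<bullet> v = J \<bullet> v" by blast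
  have iff: "conforming_solution \<Omega> V \<omega> J u \<longleftrightarrow> u \<in> V \<and> T u = z" for u
  proof (cases "u \<in> V")
    case True
    have "T u = z \<longleftrightarrow> (\<forall>v\<in>V. T u \<bullet> v = z \<bullet> v)"
      using eq_on_subspaceI[OF sub TV[OF True] z(1)] by auto
    also have "\<dots> \<longleftrightarrow> conforming_solution \<Omega> V \<omega> J u"
      using True by (simp add: conforming_solution_def T z(2) inner_commute[of J] cong: ball_cong)
    finally show ?thesis using True by simp
  qed (simp add: conforming_solution_def)
  show ?thesis
  proof (rule ex_ex1I)
    have "z \<in> T ` V" using injective_imp_surjective_on[OF fin lin] inj z(1) by auto
    then show "\<exists>u. conforming_solution \<Omega> V \<omega> J u" using iff by blast
  next
    fix u u' assume "conforming_solution \<Omega> V \<omega> J u" "conforming_solution \<Omega> V \<omega> J u'"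
    then have u: "u \<in> V" "u' \<in> V" "T u = z" "T u' = z" using iff by auto
    then have "T (u - u') = 0" by (simp add: linear_map_on_diff[OF sub lin])
    then show "u = u'" using inj[of "u - u'"] u subspace_diff[OF sub] by auto
  qed
qed

lemma nonconforming_iff_conforming:
  assumes fin: "finite_dim_subspace V1" and P: "conforming_projection V1 V1c P"
    and sub: "V1c \<subseteq> V1" and curl: "linear_map_on V1c V2 (curl \<Omega>)" and \<alpha>: "\<alpha> \<noteq> 0"
  shows "nonconforming_solution \<Omega> V1 V2 P \<omega> \<alpha> J u \<longleftrightarrow> conforming_solution \<Omega> V1c \<omega> J u"
proof -
  have V1: "subspace V1" by (rule finite_dim_subspace_subspace[OF fin])
  have PL: "linear_map_on V1 V1 P" and PP: "\<And>v. v \<in> V1 \<Longrightarrow> P (P v) = P v" and PV: "P ` V1 = V1c"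
    using P by (auto simp: conforming_projection_def)
  have PV1: "P v \<in> V1" if "v \<in> V1" for v by (rule linear_map_onD(1)[OF PL that])
  have Pc: "P v \<in> V1c" if "v \<in> V1" for v using that PV by blast
  have fix_c: "P v = v" if "v \<in> V1c" for v using that PV PP by force
  have QL: "linear_map_on V1 V1 (\<lambda>v. v - P v)"
    unfolding linear_map_on_def
    using PV1 linear_map_onD(2,3)[OF PL] by (auto simp: subspace_diff[OF V1] algebra_simps)
  have CL: "linear_map_on V1 V2 (curl_h \<Omega> P)"
    unfolding linear_map_on_def curl_h_def
    using linear_map_onD[OF curl] linear_map_onD(2,3)[OF PL] Pc by auto
  have "linear_map_on V1 UNIV (\<lambda>v. J \<bullet> P v)"
    using linear_map_onD(2,3)[OF PL] by (auto simp: linear_map_on_def inner_add_right)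
  from theI'[OF riesz_on[OF fin this]]
  have src: "source_proj V1 P J \<in> V1" "\<And>v. v \<in> V1 \<Longrightarrow> source_proj V1 P J \<bullet> v = J \<bullet> P v"
    unfolding source_proj_def by blast+
  \<comment> \<open>Every operator in the equation, the source projection included, is defined by
    moving a map onto the test vector. Tested, the equation involves only \<open>P u\<close>,
    \<open>P v\<close> and the two jumps.\<close>
  have weak: "nonconforming_solution \<Omega> V1 V2 P \<omega> \<alpha> J u \<longleftrightarrow> (\<forall>v\<in>V1.
      - \<omega>\<^sup>2 * (P u \<bullet> P v) + curl \<Omega> (P u) \<bullet> curl \<Omega> (P v) + \<alpha> * ((u - P u) \<bullet> (v - P v)) = J \<bullet> P v)"
    if u: "u \<in> V1"
  proof -
    let ?L = "- (\<omega>\<^sup>2 *\<^sub>R adjoint_on V1 V1 P (P u)) + curlt_h \<Omega> V1 V2 P (curl_h \<Omega> P u)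
       + \<alpha> *\<^sub>R jump_stab V1 P u"
    have Cu: "curl_h \<Omega> P u \<in> V2" by (rule linear_map_onD(1)[OF CL u])
    have Qu: "u - P u \<in> V1" by (rule linear_map_onD(1)[OF QL u])
    have LV: "?L \<in> V1"
      unfolding curlt_h_def jump_stab_def
      by (intro subspace_add[OF V1] subspace_neg[OF V1] subspace_scale[OF V1]
          adjoint_on(1)[OF fin PL PV1[OF u]] adjoint_on(1)[OF fin CL Cu] adjoint_on(1)[OF fin QL Qu])
    have L: "?L \<bullet> v = - \<omega>\<^sup>2 * (P u \<bullet> P v) + curl \<Omega> (P u) \<bullet> curl \<Omega> (P v)
        + \<alpha> * ((u - P u) \<bullet> (v - P v))" if v: "v \<in> V1" for v
      unfolding curlt_h_def jump_stab_def
      using adjoint_on(2)[OF fin PL PV1[OF u] v] adjoint_on(2)[OF fin CL Cu v] adjoint_on(2)[OF fin QL Qu v]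
      by (simp add: inner_add_left inner_diff_left curl_h_def)
    have "?L = source_proj V1 P J \<longleftrightarrow> (\<forall>v\<in>V1. ?L \<bullet> v = source_proj V1 P J \<bullet> v)"
      using eq_on_subspaceI[OF V1 LV src(1)] by auto
    also have "\<dots> \<longleftrightarrow> (\<forall>v\<in>V1. - \<omega>\<^sup>2 * (P u \<bullet> P v) + curl \<Omega> (P u) \<bullet> curl \<Omega> (P v)
        + \<alpha> * ((u - P u) \<bullet> (v - P v)) = J \<bullet> P v)"
      by (intro ball_cong refl) (simp only: L src(2))
    finally show ?thesis
      using u unfolding nonconforming_solution_def by blast
  qed
  show ?thesis
  proof
    assume s: "nonconforming_solution \<Omega> V1 V2 P \<omega> \<alpha> J u"
    then have u: "u \<in> V1" by (simp add: nonconforming_solution_def)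
    have eq: "- \<omega>\<^sup>2 * (P u \<bullet> P v) + curl \<Omega> (P u) \<bullet> curl \<Omega> (P v) + \<alpha> * ((u - P u) \<bullet> (v - P v)) = J \<bullet> P v"
      if "v \<in> V1" for v using weak[OF u] s that by blast
    let ?v = "u - P u"
    have v: "?v \<in> V1" by (rule linear_map_onD(1)[OF QL u])
    have Pv: "P ?v = 0" by (simp add: linear_map_on_diff[OF V1 PL u PV1[OF u]] PP[OF u])
    \<comment> \<open>Linearity of the curl is available on \<open>V1c\<close> only, so 0 has to be
      placed there before its curl can be called zero.\<close>
    have "0 \<in> V1c" using Pc[OF v] Pv by simp
    then have "curl \<Omega> 0 = 0" using linear_map_onD(3)[OF curl, of 0 0] by simp
    then have "\<alpha> * (?v \<bullet> ?v) = 0" using eq[OF v] Pv by simp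
    then have Pu: "P u = u" using \<alpha> by simp
    have "- \<omega>\<^sup>2 * (v \<bullet> u) + curl \<Omega> v \<bullet> curl \<Omega> u = v \<bullet> J" if "v \<in> V1c" for v
      using eq[of v] that sub by (simp add: Pu fix_c inner_commute subset_iff)
    moreover have "u \<in> V1c" using Pc[OF u] Pu by simp
    ultimately show "conforming_solution \<Omega> V1c \<omega> J u" by (simp add: conforming_solution_def)
  next
    assume s: "conforming_solution \<Omega> V1c \<omega> J u"
    then have u: "u \<in> V1c" by (simp add: conforming_solution_def)
    \<comment> \<open>The jump of \<open>u\<close> vanishes, and for every broken \<open>v\<close>
      the field \<open>P v\<close> is an admissible conforming test field.\<close>
    show "nonconforming_solution \<Omega> V1 V2 P \<omega> \<alpha> J u"
      using s u sub Pc by (subst weak) (auto simp: conforming_solution_def fix_c inner_commute)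
  qed
qed

theorem proposition3p2:
  fixes \<Omega> :: "(real^3) set" and K :: nat and \<Omega>s :: "nat \<Rightarrow> (real^3) set"
    and V1s V2s :: "nat \<Rightarrow> vfield set"
    and V1 V2 V1c V2c :: "vfield set"
    and P :: "vfield \<Rightarrow> vfield"
    and J :: vfield and \<alpha> \<omega> :: real
  assumes partition: "domain_partition \<Omega> K \<Omega>s"
    and local_V1: "\<And>k. k \<in> {1..K} \<Longrightarrow> finite_dim_subspace (V1s k) \<and> V1s k \<subseteq> Hcurl (\<Omega>s k)"
    and local_V2: "\<And>k. k \<in> {1..K} \<Longrightarrow> finite_dim_subspace (V2s k) \<and> V2s k \<subseteq> Hdiv (\<Omega>s k)"
    and local_curl: "\<And>k. k \<in> {1..K} \<Longrightarrow> curl (\<Omega>s k) ` V1s k \<subseteq> V2s k"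
    and V1_def: "V1 = broken_space \<Omega> K \<Omega>s V1s"
    and V2_def: "V2 = broken_space \<Omega> K \<Omega>s V2s"
    and V1c_def: "V1c = V1 \<inter> H0curl \<Omega>"
    and V2c_def: "V2c = V2 \<inter> H0div \<Omega>"
    and P: "conforming_projection V1 V1c P"
    and J: "J \<in> L2 \<Omega>"
    and \<alpha>: "\<alpha> \<noteq> 0"
    and \<omega>: "\<not> eigenvalue_on V1c (\<lambda>v. curlt_c \<Omega> V1c V2c (curl \<Omega> v)) (\<omega>\<^sup>2)"
  shows "(\<exists>!u. nonconforming_solution \<Omega> V1 V2 P \<omega> \<alpha> J u)
    \<and> (\<forall>u. nonconforming_solution \<Omega> V1 V2 P \<omega> \<alpha> J u \<longrightarrow>
           u \<in> V1c \<and> conforming_solution \<Omega> V1c \<omega> J u)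
    \<and> (\<forall>P' \<alpha>' u u'. conforming_projection V1 V1c P' \<and> \<alpha>' \<noteq> 0
           \<and> nonconforming_solution \<Omega> V1 V2 P \<omega> \<alpha> J u
           \<and> nonconforming_solution \<Omega> V1 V2 P' \<omega> \<alpha>' J u' \<longrightarrow> u = u')"
proof -
  have op: "open \<Omega>" using partition by (simp add: domain_partition_def domain_def)
  have fin: "finite_dim_subspace V1"
    unfolding V1_def by (rule finite_dim_broken_space[OF partition]) (use local_V1 in blast)
  have sub: "V1c \<subseteq> V1" and Hc: "V1c \<subseteq> Hcurl \<Omega>" by (auto simp: V1c_def H0curl_def)
  \<comment> \<open>Read off from \<open>V1c\<close> being the range of the linear map
    \<open>P\<close>.\<close>
  have "subspace V1c"
    using subspace_linear_map_on_image[OF finite_dim_subspace_subspace[OF fin]] P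
    by (metis conforming_projection_def)
  then have finc: "finite_dim_subspace V1c"
    using fin sub unfolding finite_dim_subspace_def[of V1] by (metis finite_dim_subspaceI)
  have "curl \<Omega> v \<in> V2c" if "v \<in> V1c" for v
    using that Hc curl_in_broken_space[OF partition local_curl] curl_H0curl_in_H0div[OF op]
    by (auto simp: V1c_def V2c_def V1_def V2_def)
  then have curl_c: "linear_map_on V1c V2c (curl \<Omega>)"
    using linear_map_on_curl[OF op Hc] by (auto simp: linear_map_on_def)
  \<comment> \<open>Two codomains are needed: \<open>curlt_h\<close> is an adjoint relative to
    \<open>V2\<close>, while \<open>curlt_c\<close> in the eigenvalue hypothesis is one relative to
    \<open>V2c\<close>.\<close>
  then have curl: "linear_map_on V1c V2 (curl \<Omega>)"
    by (auto simp: linear_map_on_def V2c_def)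
  \<comment> \<open>Stated for an arbitrary projection and nonzero parameter: the right-hand side
    mentions neither, which is the claimed independence.\<close>
  have iff: "nonconforming_solution \<Omega> V1 V2 P' \<omega> \<alpha>' J u \<longleftrightarrow> conforming_solution \<Omega> V1c \<omega> J u"
    if "conforming_projection V1 V1c P'" "\<alpha>' \<noteq> 0" for P' \<alpha>' u
    by (rule nonconforming_iff_conforming[OF fin that(1) sub curl that(2)])
  have ex1: "\<exists>!u. conforming_solution \<Omega> V1c \<omega> J u"
    by (rule conforming_solution_exists_unique[OF finc curl_c \<omega>])
  have "u \<in> V1c" if "conforming_solution \<Omega> V1c \<omega> J u" for u
    using that by (simp add: conforming_solution_def)
  with ex1 show ?thesis
    using iff[OF P \<alpha>] iff by auto
qed

end
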